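(* For any non-negative integers $a,b,c$, the number of triangulations of $\Delta(a,b,c)$ equals \[ \sum_{\alpha,\beta,\gamma\ge0}\binom{a}{\alpha+\beta}\binom{b}{\beta+\gamma}\binom{c}{\gamma+\alpha}. \] In particular, the number of triangulations of a triangle each of whose sides is subdivided by $r-1$ points is $\sum_{i,j,k\ge0}\binom{r-1}{i+j}\binom{r-1}{j+k}\binom{r-1}{i+k}$.
   Context: $\Delta(a,b,c)$ is a triangle $ABC$ whose side $BC$ is subdivided by $a$ points, side $CA$ by $b$ points and side $AB$ by $c$ points (all lying on the respective sides). A triangulation is a maximal dissection of the triangle into triangles by non-crossing segments between these $a+b+c+3$ points (no point lies in the interior of a side of a triangle). *)

theory Defs
  imports "HOL-Analysis.Analysis" "HOL-Library.Groups_Big_Fun"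
begin

text \<open>
  \<open>Delta a b c A B C V\<close>: \<open>V\<close> is the set of the \<open>a + b + c + 3\<close> points (corners and subdivision
  points) of some realisation of \<open>\<Delta>(a,b,c)\<close> on the non-degenerate triangle \<open>ABC\<close>.
\<close>

definition Delta ::
  "nat \<Rightarrow> nat \<Rightarrow> nat \<Rightarrow> real^2 \<Rightarrow> real^2 \<Rightarrow> real^2 \<Rightarrow> (real^2) set \<Rightarrow> bool" where
  "Delta a b c A B C V \<longleftrightarrow>
     \<not> collinear {A, B, C} \<and>
     (\<exists>P Q R. P \<subseteq> open_segment B C \<and> finite P \<and> card P = a \<and>
              Q \<subseteq> open_segment C A \<and> finite Q \<and> card Q = b \<and>
              R \<subseteq> open_segment A B \<and> finite R \<and> card R = c \<and>
              V = {A, B, C} \<union> P \<union> Q \<union> R)"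

text \<open>
  Triangles are represented by their sets of three vertices. Two triangles of a dissection have
  no interior point in common, so none of the segments used as sides cross.
\<close>

definition dissection :: "(real^2) set \<Rightarrow> (real^2) set set \<Rightarrow> bool" where
  "dissection V T \<longleftrightarrow>
     (\<forall>t\<in>T. t \<subseteq> V \<and> card t = 3 \<and> \<not> collinear t) \<and>
     (\<Union>t\<in>T. convex hull t) = convex hull V \<and>
     (\<forall>s\<in>T. \<forall>t\<in>T. s \<noteq> t \<longrightarrow> interior (convex hull s) \<inter> interior (convex hull t) = {})"

definition refines :: "(real^2) set set \<Rightarrow> (real^2) set set \<Rightarrow> bool" where
  "refines T' T \<longleftrightarrow> (\<forall>s\<in>T'. \<exists>t\<in>T. convex hull s \<subseteq> convex hull t)"

text \<open>
  The library's \<^const>\<open>triangulation\<close> (a finite set of simplices meeting face to face) imposes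
  neither the given vertex set nor maximality, hence the separate notion. The second conjunct
  spells out that no given point lies in the interior of a side of a triangle; it is a consequence
  of maximality, since otherwise that triangle could be cut by the segment joining such a point
  to the opposite vertex.
\<close>

definition triangulates :: "(real^2) set set \<Rightarrow> (real^2) set \<Rightarrow> bool" where
  "triangulates T V \<longleftrightarrow>
     dissection V T \<and>
     (\<forall>t\<in>T. \<forall>p\<in>t. \<forall>q\<in>t. open_segment p q \<inter> V = {}) \<and>
     (\<forall>T'. dissection V T' \<and> refines T' T \<longrightarrow> T' = T)"

text \<open>
  The sum over all \<open>\<alpha>, \<beta>, \<gamma> \<ge> 0\<close> is written with \<^const>\<open>Sum_any\<close>, the sum over the support of the
  summand; its value would be \<open>0\<close> by convention if that support were
  infinite, but here it is finite.
\<close>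

lemma finite_support_binomial_triple:
  "finite {x :: nat \<times> nat \<times> nat. (case x of (\<alpha>, \<beta>, \<gamma>) \<Rightarrow>
     (a choose (\<alpha> + \<beta>)) * (b choose (\<beta> + \<gamma>)) * (c choose (\<gamma> + \<alpha>))) \<noteq> 0}"
proof (rule finite_subset)
  show "{x :: nat \<times> nat \<times> nat. (case x of (\<alpha>, \<beta>, \<gamma>) \<Rightarrow>
     (a choose (\<alpha> + \<beta>)) * (b choose (\<beta> + \<gamma>)) * (c choose (\<gamma> + \<alpha>))) \<noteq> 0}
     \<subseteq> {..a} \<times> {..a} \<times> {..b}"
    by auto
qed simp

lemma Delta_exists:
  assumes "\<not> collinear {A, B, C}"
  shows "\<exists>V. Delta a b c A B C V"
proof -
  have "infinite (open_segment B C)" "infinite (open_segment C A)" "infinite (open_segment A B)"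
    using assms by (auto simp: insert_commute)
  then show ?thesis
    using assms unfolding Delta_def by (metis infinite_arbitrarily_large)
qed

end

theory Submission
  imports Defs
begin

text \<open>
  The marked points lie in cyclic order \<open>v 0, \<dots>, v n\<close> on the boundary of the triangle, starting at
  \<open>A\<close> and passing through \<open>C\<close> and \<open>B\<close>. In any triangulation of the polygon \<open>v i, \<dots>, v j\<close>, the side
  \<open>v i v j\<close> belongs to a unique triangle; its third vertex \<open>v k\<close> cuts the polygon into \<open>v i, \<dots>, v k\<close>
  and \<open>v k, \<dots>, v j\<close>, which gives the same recursion as for Catalan numbers, except that \<open>v k\<close> must not
  be separated from \<open>v i\<close> or \<open>v j\<close> by further points on a common side of the triangle. Hence \<open>k\<close> is
  \<open>i + 1\<close>, \<open>j - 1\<close>, or a point on the side opposite to \<open>A\<close>. Polygons around a single corner are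
  counted by binomial coefficients. Polygons around both \<open>C\<close> and \<open>B\<close> then satisfy a Pascal-like
  recursion with a Vandermonde-type inhomogeneous term, and the triple sum satisfies the same one.
\<close>

section \<open>Orientation of plane triangles\<close>

text \<open>Collinear triples abound here, so no argument may assume strict convexity: every
  position is expressed by the sign of a signed area, with zero allowed. The one place where the
  linear order of the points misleads is \<open>A\<close>, which is collinear with the last points
  of the order as well as with the first ones. It needs its own cases in the geometry and its own
  recursion for the full polygon. Maximality costs nothing: a triangle whose sides are free of
  further marked points contains no marked point besides its vertices, so it cannot be refined.
  Finally, the uniform recursion holds for polygons with \<open>A\<close> cut off, and these are not
  what the triple sum counts. The two agree after adding the number of triangulations in which
  \<open>A\<close> is joined to a subdivision point of \<open>BC\<close>, a single binomial
  coefficient.\<close>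

definition orient :: "real^2 \<Rightarrow> real^2 \<Rightarrow> real^2 \<Rightarrow> real" where
  "orient p q r = (q$1 - p$1) * (r$2 - p$2) - (q$2 - p$2) * (r$1 - p$1)"

lemma orient_rotate: "orient q r p = orient p q r"
  by (simp add: orient_def algebra_simps)

lemma orient_swap: "orient q p r = - orient p q r"
  by (simp add: orient_def algebra_simps)

lemma orient_degenerate [simp]:
  "orient p p r = 0" "orient p q p = 0" "orient p q q = 0"
  by (simp_all add: orient_def algebra_simps)

lemma orient_affine2:
  assumes "u + v = 1"
  shows "orient p q (u *\<^sub>R x + v *\<^sub>R y) = u * orient p q x + v * orient p q y"
proof -
  have v: "v = 1 - u" using assms by simp
  show ?thesis unfolding v by (simp add: orient_def algebra_simps)
qed

lemma orient_affine3:
  assumes "u + v + w = 1"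
  shows "orient p q (u *\<^sub>R x + v *\<^sub>R y + w *\<^sub>R z) =
    u * orient p q x + v * orient p q y + w * orient p q z"
proof -
  have u: "u = 1 - v - w" using assms by simp
  show ?thesis unfolding u by (simp add: orient_def algebra_simps)
qed

lemma orient_sum: "orient q r x + orient r p x + orient p q x = orient p q r"
  by (simp add: orient_def algebra_simps)

text \<open>Barycentric coordinates, with the denominator \<open>orient p q r\<close> cleared so
  that degenerate triangles need no exception.\<close>

lemma orient_coords:
  "orient p q r *\<^sub>R x = orient q r x *\<^sub>R p + orient r p x *\<^sub>R q + orient p q x *\<^sub>R r"
  unfolding vec_eq_iff forall_2
  by (simp add: orient_def algebra_simps)

lemma orient_line:
  assumes "orient p q x = 0" "p \<noteq> q"
  obtains u where "x = p + u *\<^sub>R (q - p)"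
proof (cases "q$1 = p$1")
  case True
  then have ne: "q$2 \<noteq> p$2" using assms(2) by (auto simp: vec_eq_iff forall_2)
  have "x$1 = p$1" using assms(1) True ne by (simp add: orient_def)
  then have "x = p + ((x$2 - p$2) / (q$2 - p$2)) *\<^sub>R (q - p)"
    using True ne by (simp add: vec_eq_iff forall_2)
  then show ?thesis by (rule that)
next
  case False
  have ne: "q$1 - p$1 \<noteq> 0" using False by simp
  have "x$2 - p$2 = (x$1 - p$1) / (q$1 - p$1) * (q$2 - p$2)"
    using assms(1) ne by (simp add: orient_def nonzero_eq_divide_eq mult.commute)
  then have "x = p + ((x$1 - p$1) / (q$1 - p$1)) *\<^sub>R (q - p)"
    using ne by (simp add: vec_eq_iff forall_2)
  then show ?thesis by (rule that)
qed

lemma collinear_iff_orient: "collinear {p, q, r} \<longleftrightarrow> orient p q r = 0"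
proof (cases "p = q")
  case False
  show ?thesis
  proof
    assume "collinear {p, q, r}"
    then obtain u where "\<forall>x\<in>{p,q,r}. \<forall>y\<in>{p,q,r}. \<exists>c. x - y = c *\<^sub>R u"
      unfolding collinear_def by blast
    then obtain c d where "q - p = c *\<^sub>R u" "r - p = d *\<^sub>R u" by blast
    then have "q = p + c *\<^sub>R u" "r = p + d *\<^sub>R u" by (simp_all add: algebra_simps)
    then show "orient p q r = 0" by (simp add: orient_def)
  next
    assume "orient p q r = 0"
    then obtain u where "r = p + u *\<^sub>R (q - p)" using False orient_line by blast
    then show "collinear {p, q, r}"
      unfolding collinear_alt
      by - (rule exI[of _ p], rule exI[of _ "q - p"], auto intro: exI[of _ 0] exI[of _ 1])
  qed
qed simp

lemma noncollinear_triple: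
  assumes "card t = 3" "\<not> collinear t"
  obtains p q r where "t = {p, q, r}" "0 < orient p q r"
proof -
  obtain p q r where t: "t = {p, q, r}" using assms(1) by (auto simp: card_3_iff)
  have "orient p q r \<noteq> 0" using assms(2) t collinear_iff_orient by simp
  then consider "0 < orient p q r" | "0 < orient q p r" by (metis orient_swap neg_0_less_iff_less linorder_neqE)
  then show ?thesis
  proof cases
    case 1 then show ?thesis using that t by blast
  next
    case 2 then show ?thesis using that[of q p r] t by blast
  qed
qed

section \<open>Triangles as intersections of half-planes\<close>

lemma convex_orient_ge: "convex {x. 0 \<le> orient p q x}"
  unfolding convex_def by (auto simp: orient_affine2)

lemma hull_orient_ge:
  assumes "\<And>x. x \<in> S \<Longrightarrow> 0 \<le> orient p q x" "x \<in> convex hull S"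
  shows "0 \<le> orient p q x"
  using hull_minimal[of S "{x. 0 \<le> orient p q x}" convex] convex_orient_ge assms by blast

lemma hull_orient_le:
  assumes "\<And>x. x \<in> S \<Longrightarrow> orient p q x \<le> 0" "x \<in> convex hull S"
  shows "orient p q x \<le> 0"
  using hull_orient_ge[of S q p x] assms by (simp add: orient_swap[of q p])

text \<open>The three areas seen from \<open>x\<close>, divided by \<open>orient p q r\<close>, are
  its barycentric coordinates.\<close>

lemma mem_triangle_iff:
  assumes "0 < orient p q r"
  shows "x \<in> convex hull {p, q, r} \<longleftrightarrow> 0 \<le> orient p q x \<and> 0 \<le> orient q r x \<and> 0 \<le> orient r p x"
    (is "_ \<longleftrightarrow> ?R")
proof
  assume x: "x \<in> convex hull {p, q, r}"
  have *: "0 \<le> orient q r p" "0 \<le> orient r p q" using assms by (simp_all add: orient_rotate)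
  show ?R
    by (intro conjI hull_orient_ge[OF _ x]) (use assms * in auto)
next
  assume R: ?R
  let ?D = "orient p q r"
  have "x = (orient q r x / ?D) *\<^sub>R p + (orient r p x / ?D) *\<^sub>R q + (orient p q x / ?D) *\<^sub>R r"
  proof -
    have "x = inverse ?D *\<^sub>R (?D *\<^sub>R x)" using assms by simp
    also have "\<dots> = inverse ?D *\<^sub>R (orient q r x *\<^sub>R p + orient r p x *\<^sub>R q + orient p q x *\<^sub>R r)"
      by (subst orient_coords) simp
    finally show ?thesis by (simp add: scaleR_right_distrib field_simps)
  qed
  moreover have "orient q r x / ?D + orient r p x / ?D + orient p q x / ?D = 1"
    using assms orient_sum[of q r x p] by (simp flip: add_divide_distrib)
  ultimately show "x \<in> convex hull {p, q, r}"
    unfolding convex_hull_3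
    by - (rule CollectI, rule exI[of _ "orient q r x / ?D"], rule exI[of _ "orient r p x / ?D"],
        rule exI[of _ "orient p q x / ?D"], use R assms in simp)
qed

lemma continuous_on_orient: "continuous_on UNIV (orient p q)"
  unfolding orient_def by (intro continuous_intros)

lemma interior_triangleI:
  assumes "0 < orient p q x" "0 < orient q r x" "0 < orient r p x"
  shows "x \<in> interior (convex hull {p, q, r})"
proof (rule interiorI)
  have D: "0 < orient p q r" using assms orient_sum[of q r x p] by linarith
  have o: "open {y. 0 < orient a b y}" for a b
    using open_Collect_less[OF continuous_on_const continuous_on_orient] .
  show "open ({y. 0 < orient p q y} \<inter> {y. 0 < orient q r y} \<inter> {y. 0 < orient r p y})"
    by (intro open_Int o)
  show "{y. 0 < orient p q y} \<inter> {y. 0 < orient q r y} \<inter> {y. 0 < orient r p y} \<subseteq> convex hull {p, q, r}"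
    by (auto simp: mem_triangle_iff[OF D])
qed (use assms in auto)

lemma triangle_interior_nonempty:
  fixes t :: "(real^2) set"
  assumes "card t = 3" "\<not> collinear t"
  shows "interior (convex hull t) \<noteq> {}"
proof -
  obtain p q r where t: "t = {p, q, r}" and D: "0 < orient p q r"
    using noncollinear_triple assms by blast
  let ?x = "(1/3) *\<^sub>R p + (1/3) *\<^sub>R q + (1/3) *\<^sub>R r"
  have r: "orient q r p = orient p q r" "orient r p q = orient p q r" by (simp_all add: orient_rotate)
  have "?x \<in> interior (convex hull {p, q, r})"
    by (rule interior_triangleI) (use D in \<open>simp_all add: orient_affine3 r\<close>)
  then show ?thesis using t by blast
qed

lemma triangle_edge:
  assumes "0 < orient p q r" "x \<in> convex hull {p, q, r}" "orient p q x = 0"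
  shows "x \<in> closed_segment p q"
proof -
  obtain u v w where *: "0 \<le> u" "0 \<le> v" "0 \<le> w" "u + v + w = 1" "x = u *\<^sub>R p + v *\<^sub>R q + w *\<^sub>R r"
    using assms(2) unfolding convex_hull_3 by blast
  have "w * orient p q r = 0" using assms(3) * by (simp add: orient_affine3)
  then have "w = 0" using assms(1) by simp
  then show ?thesis using * unfolding closed_segment_def by (auto intro!: exI[of _ v])
qed

lemma interior_orient_le:
  assumes "p \<noteq> q" "x \<in> interior {x. orient p q x \<le> 0}"
  shows "orient p q x < 0"
proof -
  \<comment> \<open>The vector \<open>q - p\<close> after a quarter turn, so that
    \<open>orient p q\<close> becomes an inner product up to a constant.\<close>
  define a :: "real^2" where "a = vector [p$2 - q$2, q$1 - p$1]"
  have a: "a \<noteq> 0" using assms(1) by (auto simp: a_def vec_eq_iff forall_2)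
  have "orient p q x = a \<bullet> x - a \<bullet> p" for x
    by (simp add: a_def inner_vec_def sum_2 orient_def algebra_simps)
  then have "{x. orient p q x \<le> 0} = {x. a \<bullet> x \<le> a \<bullet> p}" "orient p q x < 0 \<longleftrightarrow> a \<bullet> x < a \<bullet> p" by auto
  then show ?thesis using assms(2) interior_halfspace_le[OF a, of "a \<bullet> p"] by simp
qed

lemma interiors_disjoint_separated:
  assumes "p \<noteq> q" "\<And>x. x \<in> s \<Longrightarrow> orient p q x \<le> 0" "\<And>x. x \<in> t \<Longrightarrow> 0 \<le> orient p q x"
  shows "interior (convex hull s) \<inter> interior (convex hull t) = {}"
proof -
  have "x \<notin> interior (convex hull t)" if x: "x \<in> interior (convex hull s)" for x
  proof
    assume t: "x \<in> interior (convex hull t)"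
    have "convex hull s \<subseteq> {x. orient p q x \<le> 0}" using hull_orient_le assms(2) by blast
    then have "orient p q x < 0" using interior_orient_le[OF assms(1)] interior_mono x by blast
    moreover have "0 \<le> orient p q x" using hull_orient_ge[of t] assms(3) t interior_subset by blast
    ultimately show False by simp
  qed
  then show ?thesis by blast
qed

text \<open>A triangle is the closure of its interior, so an open set that touches it meets its
  interior. Thus a single point of \<open>s\<close>, even a boundary point, suffices to contradict
  disjointness of interiors.\<close>

lemma interiors_meet:
  fixes s :: "(real^2) set"
  assumes "card s = 3" "\<not> collinear s" "x \<in> convex hull s" "x \<in> interior (convex hull t)"
  shows "interior (convex hull s) \<inter> interior (convex hull t) \<noteq> {}"
proof -
  have "x \<in> closure (interior (convex hull s))"
    using assms(3) convex_closure_interior[OF convex_convex_hull triangle_interior_nonempty[OF assms(1,2)]]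
      closure_subset by blast
  then show ?thesis
    using assms(4) open_Int_closure_eq_empty[of "interior (convex hull t)" "interior (convex hull s)"]
    by blast
qed

lemma open_segment_orient:
  assumes "x \<in> open_segment p q"
  shows "orient p q x = 0"
  using assms by (auto simp: in_segment orient_affine2)

section \<open>Segments crossing lines\<close>

lemma orient_swap2: "orient p r q = - orient p q r"
  by (simp add: orient_def algebra_simps)

text \<open>A Pluecker relation. It expresses on which side of \<open>q\<close> the segment from
  \<open>x\<close> to \<open>y\<close> passes by the values of \<open>orient p q\<close> and
  \<open>orient q r\<close> at its ends.\<close>

lemma orient_product:
  "orient q r x * orient p q y - orient p q x * orient q r y = orient p q r * orient x q y"
  by (simp add: orient_def algebra_simps)

lemma collinear_if_orient_zero:
  assumes "p \<noteq> q" "\<And>x. x \<in> S \<Longrightarrow> orient p q x = 0"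
  shows "collinear S"
  unfolding collinear_alt
proof (rule exI[of _ p], rule exI[of _ "q - p"], rule ballI)
  fix x assume "x \<in> S"
  then show "\<exists>c. x = p + c *\<^sub>R (q - p)" using orient_line[OF assms(2) assms(1)] by blast
qed

text \<open>By \<open>orient_product\<close>, for \<open>0 < orient p q r\<close> the hypothesis
  \<open>less\<close> means \<open>0 < orient a q b\<close>: the segment from \<open>a\<close> to
  \<open>b\<close> passes \<open>q\<close> on the inner side of the corner.\<close>

lemma crossing_point:
  assumes a: "orient p q a \<le> 0" "0 \<le> orient q r a" and b: "0 \<le> orient p q b" "orient q r b \<le> 0"
    and less: "orient p q a * orient q r b < orient q r a * orient p q b"
  obtains z where "z \<in> open_segment a b" "0 < orient p q z" "0 < orient q r z"
proof -
  define x1 x2 y1 y2 where d: "x1 = - orient p q a" "x2 = orient q r a" "y1 = orient p q b" "y2 = - orient q r b"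
  have nn: "0 \<le> x1" "0 \<le> x2" "0 \<le> y1" "0 \<le> y2" using a b d by auto
  have lt: "x1 * y2 < x2 * y1" using less d by simp
  then have pos: "0 < x2" "0 < y1" using nn
    by (metis less_eq_real_def mult_nonneg_nonneg mult_zero_left mult_zero_right not_less)+
  define w where "w = x1 + x2 + y1 + y2"
  have w: "0 < w" using pos nn w_def by simp
  \<comment> \<open>This weight makes \<open>orient p q\<close> and \<open>orient q r\<close> equal
    at the point; their common value is \<open>(x2 * y1 - x1 * y2) / w\<close>.\<close>
  define u where "u = (x1 + x2) / w"
  have u: "0 < u" "u < 1" using pos nn w by (auto simp: u_def w_def)
  have u': "1 - u = (y1 + y2) / w" using w by (simp add: u_def w_def field_simps)
  let ?z = "(1 - u) *\<^sub>R a + u *\<^sub>R b"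
  have "orient p q ?z = (x2 * y1 - x1 * y2) / w" "orient q r ?z = (x2 * y1 - x1 * y2) / w"
    unfolding orient_affine2[OF diff_add_cancel] unfolding u'
    using d by (simp_all add: u_def algebra_simps diff_divide_distrib add_divide_distrib)
  then have "0 < orient p q ?z" "0 < orient q r ?z" using lt w by simp_all
  moreover have "a \<noteq> b" using a b pos d by auto
  then have "?z \<in> open_segment a b" using u by (auto simp: in_segment)
  ultimately show ?thesis by (rule that[rotated])
qed

text \<open>The equation for \<open>s\<close> is exported without division, the form in which
  \<open>hull_split\<close> eliminates \<open>s\<close>.\<close>

lemma segment_meets_line:
  assumes y: "orient p q y \<le> 0" "0 \<le> orient p q y'" and x: "x \<in> closed_segment y y'" "orient p q x < 0"
  obtains s where "0 \<le> s" "s \<le> 1" "s * (orient p q y' - orient p q y) = - orient p q y"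
    "orient p q ((1 - s) *\<^sub>R y + s *\<^sub>R y') = 0"
    "x \<in> closed_segment y ((1 - s) *\<^sub>R y + s *\<^sub>R y')"
proof -
  define a b where d: "a = - orient p q y" "b = orient p q y'"
  obtain u where u: "0 \<le> u" "u \<le> 1" "x = (1 - u) *\<^sub>R y + u *\<^sub>R y'" using x(1) by (auto simp: in_segment)
  have ux: "- (1 - u) * a + u * b < 0"
    using x(2) unfolding u(3) orient_affine2[OF diff_add_cancel] by (simp add: d algebra_simps)
  have ab: "0 \<le> a" "0 \<le> b" using y d by simp_all
  have a: "0 < a"
  proof (rule ccontr)
    assume "\<not> 0 < a"
    then have "a = 0" using ab by simp
    then show False using ux ab u by (simp add: mult_less_0_iff)
  qed
  define s where "s = a / (a + b)"
  have s: "0 < s" "s \<le> 1" using a ab by (auto simp: s_def)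
  have sm: "s * (a + b) = a" using a ab by (simp add: s_def)
  have us: "u < s"
  proof -
    have "u * (a + b) < s * (a + b)" using ux sm by (simp add: algebra_simps)
    then show ?thesis using a ab by (simp add: mult_less_cancel_right)
  qed
  let ?z = "(1 - s) *\<^sub>R y + s *\<^sub>R y'"
  have "x = (1 - u / s) *\<^sub>R y + (u / s) *\<^sub>R ?z"
  proof -
    have "(1 - u / s) *\<^sub>R y + (u / s) *\<^sub>R ?z = (1 - u / s + u / s * (1 - s)) *\<^sub>R y + (u / s * s) *\<^sub>R y'"
      by (simp add: scaleR_add_left scaleR_add_right)
    also have "1 - u / s + u / s * (1 - s) = 1 - u" using s by (simp add: field_simps)
    also have "u / s * s = u" using s by simp
    finally show ?thesis using u(3) by simp
  qed
  then have "x \<in> closed_segment y ?z" unfolding in_segment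
    using u(1) us s by (intro exI[of _ "u / s"]) auto
  moreover have "orient p q ?z = 0"
    unfolding orient_affine2[OF diff_add_cancel] using sm d by (simp add: algebra_simps)
  moreover have "s * (orient p q y' - orient p q y) = - orient p q y" using sm d by (simp add: add.commute)
  ultimately show ?thesis using s by (intro that[of s]) auto
qed

section \<open>Triangulations of weakly convex chains\<close>

text \<open>A dissection without the covering condition, but with all sides free of marked points.
  Unlike covering, this passes directly to the triangles over a subset of the points, see
  \<open>packing_restrict\<close>.\<close>

definition packing :: "(real^2) set \<Rightarrow> (real^2) set set \<Rightarrow> bool" where
  "packing V T \<longleftrightarrow>
     (\<forall>t\<in>T. t \<subseteq> V \<and> card t = 3 \<and> \<not> collinear t \<and> (\<forall>p\<in>t. \<forall>q\<in>t. open_segment p q \<inter> V = {})) \<and>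
     (\<forall>s\<in>T. \<forall>t\<in>T. s \<noteq> t \<longrightarrow> interior (convex hull s) \<inter> interior (convex hull t) = {})"

lemma packingD:
  assumes "packing V T" "t \<in> T"
  shows "t \<subseteq> V" "card t = 3" "\<not> collinear t"
    "\<And>p q. p \<in> t \<Longrightarrow> q \<in> t \<Longrightarrow> open_segment p q \<inter> V = {}"
    "\<And>s. s \<in> T \<Longrightarrow> s \<noteq> t \<Longrightarrow> interior (convex hull s) \<inter> interior (convex hull t) = {}"
  using assms unfolding packing_def by blast+

text \<open>Zero is allowed so that several points may lie on one side of the triangle.\<close>

locale convex_chain =
  fixes v :: "nat \<Rightarrow> real^2" and N :: nat
  assumes inj: "inj_on v {..N}"
    and orient_nonneg: "\<And>p q r. p < q \<Longrightarrow> q < r \<Longrightarrow> r \<le> N \<Longrightarrow> 0 \<le> orient (v p) (v q) (v r)"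
begin

definition pts :: "nat \<Rightarrow> nat \<Rightarrow> (real^2) set" where
  "pts i j = v ` {i..j}"

text \<open>The set \<open>S\<close> is a parameter because a chord from \<open>v 0\<close> can be
  blocked by points whose indices lie beyond both of its ends.\<close>

definition clear :: "nat \<Rightarrow> nat \<Rightarrow> (real^2) set \<Rightarrow> bool" where
  "clear i j S \<longleftrightarrow> open_segment (v i) (v j) \<inter> S = {}"

text \<open>Adding the base segment to the union gives a polygon that is a single edge exactly one
  filling, the empty one, which starts the recursion. If the points are not collinear and the base
  is clear, a triangle covers the base anyway.\<close>

definition fillings :: "nat \<Rightarrow> nat \<Rightarrow> (real^2) set set set" where
  "fillings i j = {T. packing (pts i j) T \<and>
     (\<Union>t\<in>T. convex hull t) \<union> closed_segment (v i) (v j) = convex hull (pts i j)}"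

definition apices :: "nat \<Rightarrow> nat \<Rightarrow> nat set" where
  "apices i j = {k. i < k \<and> k < j \<and> 0 < orient (v i) (v k) (v j) \<and>
     clear i k (pts i j) \<and> clear k j (pts i j)}"

lemma orient_nonneg': "p \<le> q \<Longrightarrow> q \<le> r \<Longrightarrow> r \<le> N \<Longrightarrow> 0 \<le> orient (v p) (v q) (v r)"
  using orient_nonneg[of p q r] by (cases "p = q"; cases "q = r") auto

lemma v_eq_iff: "p \<le> N \<Longrightarrow> q \<le> N \<Longrightarrow> v p = v q \<longleftrightarrow> p = q"
  using inj by (auto simp: inj_on_eq_iff)

lemma finite_pts [simp]: "finite (pts i j)"
  by (simp add: pts_def)

lemma v_in_pts: "i \<le> k \<Longrightarrow> k \<le> j \<Longrightarrow> v k \<in> pts i j"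
  by (simp add: pts_def)

lemma v_in_pts_iff: "k \<le> N \<Longrightarrow> j \<le> N \<Longrightarrow> v k \<in> pts i j \<longleftrightarrow> i \<le> k \<and> k \<le> j"
  unfolding pts_def using v_eq_iff by fastforce

lemma pts_mono: "i' \<le> i \<Longrightarrow> j \<le> j' \<Longrightarrow> pts i j \<subseteq> pts i' j'"
  by (auto simp: pts_def)

lemma pts_split: "i \<le> k \<Longrightarrow> k \<le> j \<Longrightarrow> pts i j = pts i k \<union> pts k j"
  unfolding pts_def image_Un[symmetric] by (simp add: ivl_disj_un)

lemma pts_Int: "k \<le> N \<Longrightarrow> j \<le> N \<Longrightarrow> i \<le> k \<Longrightarrow> k \<le> j \<Longrightarrow> pts i k \<inter> pts k j = {v k}"
proof -
  assume *: "k \<le> N" "j \<le> N" "i \<le> k" "k \<le> j"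
  have "v ` {i..k} \<inter> v ` {k..j} = v ` ({i..k} \<inter> {k..j})"
    by (rule inj_on_image_Int[OF inj, symmetric]) (use * in auto)
  also have "{i..k} \<inter> {k..j} = {k}" using * by auto
  finally show ?thesis by (simp add: pts_def)
qed

lemma finite_packing: "packing (pts i j) T \<Longrightarrow> finite T"
  by (rule finite_subset[of _ "Pow (pts i j)"]) (auto simp: packing_def)

lemma finite_fillings: "finite (fillings i j)"
  by (rule finite_subset[of _ "Pow (Pow (pts i j))"]) (auto simp: fillings_def packing_def)

lemma card_fillings_edge: "card (fillings i (Suc i)) = 1"
proof -
  have pts: "pts i (Suc i) = {v i, v (Suc i)}"
    unfolding pts_def by (auto simp: le_Suc_eq)
  have "T = {}" if "packing (pts i (Suc i)) T" for T
  proof (rule ccontr)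
    assume "T \<noteq> {}"
    then obtain t where "t \<in> T" by blast
    then have "card t = 3" "t \<subseteq> {v i, v (Suc i)}" using packingD[OF that] pts by auto
    then show False using card_mono[of "{v i, v (Suc i)}" t] card_insert_le_m1[of 2 "{v (Suc i)}" "v i"] by simp
  qed
  moreover have "packing (pts i (Suc i)) {}" by (simp add: packing_def)
  ultimately have "fillings i (Suc i) = {{}}"
    by (auto simp: fillings_def pts segment_convex_hull)
  then show ?thesis by simp
qed

lemma finite_apices: "finite (apices i j)"
  by (rule finite_subset[of _ "{i..j}"]) (auto simp: apices_def)

section \<open>Cutting a polygon along the triangle over its base\<close>

context
  fixes i k j
  assumes ikj: "i < k" "k < j" "j \<le> N" and pos: "0 < orient (v i) (v k) (v j)"
begin

lemma left_orient:
  assumes "x \<in> pts i k"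
  shows "orient (v i) (v k) x \<le> 0" "0 \<le> orient (v k) (v j) x"
proof -
  obtain l where l: "i \<le> l" "l \<le> k" "x = v l" using assms by (auto simp: pts_def)
  show "orient (v i) (v k) x \<le> 0" "0 \<le> orient (v k) (v j) x"
    using orient_nonneg'[of i l k] orient_nonneg'[of l k j] l ikj
    unfolding orient_rotate[of "v k" "v j" x] by (simp_all add: orient_swap2[of "v i" "v k"])
qed

lemma right_orient:
  assumes "x \<in> pts k j"
  shows "0 \<le> orient (v i) (v k) x" "orient (v k) (v j) x \<le> 0"
proof -
  obtain l where l: "k \<le> l" "l \<le> j" "x = v l" using assms by (auto simp: pts_def)
  show "0 \<le> orient (v i) (v k) x" "orient (v k) (v j) x \<le> 0"
    using orient_nonneg'[of i k l] orient_nonneg'[of k l j] l ikj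
    by (simp_all add: orient_swap2[of "v k" "v j"])
qed

lemma base_orient:
  assumes "x \<in> pts i j"
  shows "0 \<le> orient (v j) (v i) x"
proof -
  obtain l where l: "i \<le> l" "l \<le> j" "x = v l" using assms by (auto simp: pts_def)
  then show ?thesis
    using orient_nonneg'[of i l j] ikj orient_rotate[of "v j" "v i" x] orient_rotate[of "v i" x "v j"]
    by simp
qed

lemma middle_orient:
  assumes "x \<in> pts i k" "y \<in> pts k j"
  shows "0 \<le> orient x (v k) y"
proof -
  obtain l m where "i \<le> l" "l \<le> k" "x = v l" "k \<le> m" "m \<le> j" "y = v m"
    using assms by (auto simp: pts_def)
  then show ?thesis using orient_nonneg'[of l k m] ikj by simp
qed

text \<open>\<open>orient\<close> is affine in each of its arguments, so the inequality passes to
  the hulls one end at a time.\<close>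

lemma middle_orient_hull:
  assumes x: "x \<in> convex hull (pts i k)" and y: "y \<in> convex hull (pts k j)"
  shows "0 \<le> orient x (v k) y"
proof -
  have "0 \<le> orient x' (v k) y" if "x' \<in> pts i k" for x'
    by (rule hull_orient_ge[OF middle_orient[OF that] y])
  then have "0 \<le> orient (v k) y x"
    by (intro hull_orient_ge[OF _ x]) (metis orient_rotate)
  then show ?thesis by (metis orient_rotate)
qed

lemma left_hull:
  assumes "x \<in> convex hull (pts i k)"
  shows "orient (v i) (v k) x \<le> 0" "0 \<le> orient (v k) (v j) x"
  using hull_orient_le[OF left_orient(1) assms] hull_orient_ge[OF left_orient(2) assms] by simp_all

lemma right_hull:
  assumes "x \<in> convex hull (pts k j)"
  shows "0 \<le> orient (v i) (v k) x" "orient (v k) (v j) x \<le> 0"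
  using hull_orient_ge[OF right_orient(1) assms] hull_orient_le[OF right_orient(2) assms] by simp_all

lemma base_hull: "x \<in> convex hull (pts i j) \<Longrightarrow> 0 \<le> orient (v j) (v i) x"
  using hull_orient_ge[OF base_orient] by blast

lemma pos': "0 < orient (v k) (v j) (v i)" "0 < orient (v j) (v i) (v k)"
  using pos by (metis orient_rotate)+

lemma triangle_subset: "{v i, v k, v j} \<subseteq> pts i j"
  using ikj by (auto simp: v_in_pts)

text \<open>The two parts lie on opposite sides of both lines, the one through \<open>v i\<close>
  and \<open>v k\<close> and the one through \<open>v k\<close> and \<open>v j\<close>, and these
  lines meet only in \<open>v k\<close>.\<close>

lemma hulls_Int:
  assumes "x \<in> convex hull (pts i k)" "x \<in> convex hull (pts k j)"
  shows "x = v k"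
proof -
  have z: "orient (v i) (v k) x = 0" "orient (v k) (v j) x = 0"
    using left_hull[OF assms(1)] right_hull[OF assms(2)] by auto
  moreover have "orient (v j) (v i) x = orient (v i) (v k) (v j)"
    using orient_sum[of "v k" "v j" x "v i"] z by simp
  ultimately have "orient (v i) (v k) (v j) *\<^sub>R x = orient (v i) (v k) (v j) *\<^sub>R v k"
    using orient_coords[of "v i" "v k" "v j" x] by simp
  then show ?thesis using pos by simp
qed

lemma triangle_left_hull:
  assumes "x \<in> convex hull {v i, v k, v j}" "x \<in> convex hull (pts i k)"
  shows "x \<in> closed_segment (v i) (v k)"
  using assms left_hull(1)[OF assms(2)] triangle_edge[OF pos assms(1)] mem_triangle_iff[OF pos, of x]
  by auto

lemma triangle_right_hull:
  assumes "x \<in> convex hull {v i, v k, v j}" "x \<in> convex hull (pts k j)"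
  shows "x \<in> closed_segment (v k) (v j)"
proof -
  have "{v k, v j, v i} = {v i, v k, v j}" by blast
  then show ?thesis
    using assms right_hull(2)[OF assms(2)] triangle_edge[OF pos'(1), of x] mem_triangle_iff[OF pos, of x]
    by auto
qed

text \<open>Every point of the hull lies on a segment from a left point \<open>y\<close> to a right
  point \<open>y'\<close>. Where this segment leaves the left part across the line through
  \<open>v i\<close> and \<open>v k\<close>, it hits the edge between them, because weak convexity
  at \<open>v k\<close> keeps it on the inner side.\<close>

lemma hull_split:
  "convex hull (pts i j) = convex hull {v i, v k, v j} \<union> convex hull (pts i k) \<union> convex hull (pts k j)"
proof
  show "convex hull {v i, v k, v j} \<union> convex hull (pts i k) \<union> convex hull (pts k j) \<subseteq> convex hull (pts i j)"
    using ikj by (intro Un_least hull_mono triangle_subset pts_mono) auto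
  show "convex hull (pts i j) \<subseteq> convex hull {v i, v k, v j} \<union> convex hull (pts i k) \<union> convex hull (pts k j)"
  proof
    fix x assume x: "x \<in> convex hull (pts i j)"
    have ne: "pts i k \<noteq> {}" "pts k j \<noteq> {}" using ikj by (auto simp: pts_def)
    have "convex hull (pts i j) = convex hull (convex hull (pts i k) \<union> convex hull (pts k j))"
      using pts_split[of i k j] ikj hull_Un_left hull_Un_right by (metis less_imp_le)
    then have "x \<in> {u *\<^sub>R s + w *\<^sub>R t | u w s t. u \<ge> 0 \<and> w \<ge> 0 \<and> u + w = 1 \<and>
        s \<in> convex hull (pts i k) \<and> t \<in> convex hull (pts k j)}"
      using x convex_hull_union_two[of "convex hull (pts i k)" "convex hull (pts k j)"] ne by simp
    then obtain u w s t where st: "0 \<le> u" "0 \<le> w" "u + w = 1" "s \<in> convex hull (pts i k)"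
      "t \<in> convex hull (pts k j)" "x = u *\<^sub>R s + w *\<^sub>R t" by blast
    have "u = 1 - w" using st(3) by simp
    then have "x \<in> closed_segment s t" using st by (auto simp: in_segment intro!: exI[of _ w])
    then have "\<exists>y\<in>convex hull (pts i k). \<exists>y'\<in>convex hull (pts k j). x \<in> closed_segment y y'"
      using st by blast
    then obtain y y' where y: "y \<in> convex hull (pts i k)" and y': "y' \<in> convex hull (pts k j)"
      and xs: "x \<in> closed_segment y y'" by blast
    let ?L1 = "orient (v i) (v k)" and ?L2 = "orient (v k) (v j)" and ?L3 = "orient (v j) (v i)"
    have ys: "?L1 y \<le> 0" "0 \<le> ?L2 y" "0 \<le> ?L1 y'" "?L2 y' \<le> 0"
      using left_hull y right_hull y' by auto
    have sub: "convex hull (pts i k) \<subseteq> convex hull (pts i j)" "convex hull (pts k j) \<subseteq> convex hull (pts i j)"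
      using ikj by (simp_all add: hull_mono pts_mono)
    have y3: "0 \<le> ?L3 y" "0 \<le> ?L3 y'" using base_hull y y' sub by auto
    \<comment> \<open>This is \<open>0 \<le> orient y (v k) y'\<close> in terms of
      \<open>?L1\<close> and \<open>?L2\<close>: the segment does not pass outside
      \<open>v k\<close>.\<close>
    have prod: "?L1 y * ?L2 y' \<le> ?L2 y * ?L1 y'"
      using orient_product[of "v k" "v j" y "v i" y']
        mult_nonneg_nonneg[OF less_imp_le[OF pos] middle_orient_hull[OF y y']] by linarith
    consider "?L1 x < 0" | "?L2 x < 0" | "0 \<le> ?L1 x" "0 \<le> ?L2 x" by linarith
    then show "x \<in> convex hull {v i, v k, v j} \<union> convex hull (pts i k) \<union> convex hull (pts k j)"
    proof cases
      case 1
      obtain s where s: "0 \<le> s" "s \<le> 1" "s * (?L1 y' - ?L1 y) = - ?L1 y"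
        "?L1 ((1 - s) *\<^sub>R y + s *\<^sub>R y') = 0" "x \<in> closed_segment y ((1 - s) *\<^sub>R y + s *\<^sub>R y')"
        using segment_meets_line[OF ys(1,3) xs 1] by blast
      define z where "z = (1 - s) *\<^sub>R y + s *\<^sub>R y'"
      \<comment> \<open>Otherwise the whole segment would lie on the line, but \<open>x\<close> is
        off it.\<close>
      have d: "0 < ?L1 y' - ?L1 y"
      proof (rule ccontr)
        assume "\<not> ?thesis"
        then have z0: "?L1 y = 0" "?L1 y' = 0" using ys by auto
        obtain u where "x = (1 - u) *\<^sub>R y + u *\<^sub>R y'" using xs by (auto simp: in_segment)
        then have "?L1 x = 0" using z0 by (simp add: orient_affine2)
        then show False using 1 by simp
      qed
      \<comment> \<open>Multiplying by the positive difference eliminates \<open>s\<close> and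
        leaves the quantity bounded in \<open>prod\<close>.\<close>
      have "?L2 z * (?L1 y' - ?L1 y) = (?L1 y' - ?L1 y) * ?L2 y - (s * (?L1 y' - ?L1 y)) * (?L2 y - ?L2 y')"
        unfolding z_def orient_affine2[OF diff_add_cancel] by (simp add: algebra_simps)
      also have "\<dots> = ?L2 y * ?L1 y' - ?L1 y * ?L2 y'" unfolding s(3) by (simp add: algebra_simps)
      finally have "0 \<le> ?L2 z * (?L1 y' - ?L1 y)" using prod by linarith
      then have "0 \<le> ?L2 z" using d unfolding zero_le_mult_iff by linarith
      moreover have "0 \<le> ?L3 z" unfolding z_def orient_affine2[OF diff_add_cancel] using s y3 by simp
      moreover have z1: "?L1 z = 0" using s(4) z_def by simp
      ultimately have "z \<in> convex hull {v i, v k, v j}" by (simp add: mem_triangle_iff[OF pos])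
      then have "z \<in> closed_segment (v i) (v k)" using triangle_edge[OF pos] z1 by blast
      moreover have "closed_segment (v i) (v k) \<subseteq> convex hull (pts i k)"
        unfolding segment_convex_hull using ikj by (intro hull_mono) (auto simp: v_in_pts)
      ultimately have "closed_segment y z \<subseteq> convex hull (pts i k)"
        using y by (intro closed_segment_subset) auto
      then show ?thesis using s(5) z_def by blast
    next
      \<comment> \<open>Mirror image of the first case, with \<open>y\<close> and \<open>y'\<close>
        exchanged.\<close>
      case 2
      have xs': "x \<in> closed_segment y' y" using xs by (simp add: closed_segment_commute)
      obtain s where s: "0 \<le> s" "s \<le> 1" "s * (?L2 y - ?L2 y') = - ?L2 y'"
        "?L2 ((1 - s) *\<^sub>R y' + s *\<^sub>R y) = 0" "x \<in> closed_segment y' ((1 - s) *\<^sub>R y' + s *\<^sub>R y)"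
        using segment_meets_line[OF ys(4,2) xs' 2] by blast
      define z where "z = (1 - s) *\<^sub>R y' + s *\<^sub>R y"
      have d: "0 < ?L2 y - ?L2 y'"
      proof (rule ccontr)
        assume "\<not> ?thesis"
        then have z0: "?L2 y = 0" "?L2 y' = 0" using ys by auto
        obtain u where "x = (1 - u) *\<^sub>R y + u *\<^sub>R y'" using xs by (auto simp: in_segment)
        then have "?L2 x = 0" using z0 by (simp add: orient_affine2)
        then show False using 2 by simp
      qed
      have "?L1 z * (?L2 y - ?L2 y') = (?L2 y - ?L2 y') * ?L1 y' - (s * (?L2 y - ?L2 y')) * (?L1 y' - ?L1 y)"
        unfolding z_def orient_affine2[OF diff_add_cancel] by (simp add: algebra_simps)
      also have "\<dots> = ?L2 y * ?L1 y' - ?L1 y * ?L2 y'" unfolding s(3) by (simp add: algebra_simps)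
      finally have "0 \<le> ?L1 z * (?L2 y - ?L2 y')" using prod by linarith
      then have "0 \<le> ?L1 z" using d unfolding zero_le_mult_iff by linarith
      moreover have "0 \<le> ?L3 z" unfolding z_def orient_affine2[OF diff_add_cancel] using s y3 by simp
      moreover have z1: "?L2 z = 0" using s(4) z_def by simp
      ultimately have "z \<in> convex hull {v i, v k, v j}" by (simp add: mem_triangle_iff[OF pos])
      then have "z \<in> convex hull {v k, v j, v i}" by (simp add: insert_commute)
      then have "z \<in> closed_segment (v k) (v j)" using triangle_edge[OF pos'(1)] z1 by blast
      moreover have "closed_segment (v k) (v j) \<subseteq> convex hull (pts k j)"
        unfolding segment_convex_hull using ikj by (intro hull_mono) (auto simp: v_in_pts)
      ultimately have "closed_segment y' z \<subseteq> convex hull (pts k j)"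
        using y' by (intro closed_segment_subset) auto
      then show ?thesis using s(5) z_def by blast
    next
      case 3
      then show ?thesis using base_hull[OF x] by (simp add: mem_triangle_iff[OF pos])
    qed
  qed
qed

text \<open>A triangle with vertices properly in both parts would have a side that either runs
  through \<open>v k\<close>, which a packing forbids, or passes on the inner side of
  \<open>v k\<close> and so brings the triangle into the interior of the one over the base.\<close>

lemma triangle_separates:
  assumes T: "packing (pts i j) T" and t: "{v i, v k, v j} \<in> T" and s: "s \<in> T" "s \<noteq> {v i, v k, v j}"
  shows "s \<subseteq> pts i k \<or> s \<subseteq> pts k j"
proof (rule ccontr)
  assume neg: "\<not> ?thesis"
  let ?L1 = "orient (v i) (v k)" and ?L2 = "orient (v k) (v j)" and ?L3 = "orient (v j) (v i)"
  have split: "pts i j = pts i k \<union> pts k j" using ikj by (simp add: pts_split)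
  have sub: "s \<subseteq> pts i j" using packingD[OF T s(1)] by simp
  then obtain a b where a: "a \<in> s" "a \<in> pts i k" "a \<notin> pts k j" and b: "b \<in> s" "b \<in> pts k j" "b \<notin> pts i k"
    using neg split by blast
  have ak: "a \<noteq> v k" and bk: "b \<noteq> v k" using a b ikj by (auto simp: v_in_pts)
  have L: "?L1 a \<le> 0" "0 \<le> ?L2 a" "0 \<le> ?L1 b" "?L2 b \<le> 0"
    using left_orient a right_orient b by auto
  have ne: "0 < orient a (v k) b"
  proof (rule ccontr)
    assume "\<not> ?thesis"
    then have "orient a (v k) b = 0" using middle_orient[OF a(2) b(2)] by simp
    then obtain u where u: "b = a + u *\<^sub>R (v k - a)" using orient_line ak by metis
    then have b_eq: "b = (1 - u) *\<^sub>R a + u *\<^sub>R v k" by (simp add: algebra_simps)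
    have L': "?L1 b = (1 - u) * ?L1 a" "?L2 b = (1 - u) * ?L2 a"
      unfolding b_eq orient_affine2[OF diff_add_cancel] by simp_all
    \<comment> \<open>For \<open>u < 1\<close> the points \<open>a\<close> and \<open>b\<close>
      would lie on the same ray from \<open>v k\<close>; the opposite signs in \<open>L\<close> then
      make \<open>?L1\<close> and \<open>?L2\<close> vanish at \<open>a\<close>.\<close>
    have "u \<ge> 1"
    proof (rule ccontr)
      assume "\<not> 1 \<le> u"
      then have "?L1 a = 0" "?L2 a = 0"
        using L L' by (auto simp: zero_le_mult_iff mult_le_0_iff)
      then have "a = v k"
        using hulls_Int orient_coords[of "v i" "v k" "v j" a] orient_sum[of "v k" "v j" a "v i"] pos
        by simp
      then show False using ak by simp
    qed
    moreover have "u \<noteq> 1" using b_eq bk by auto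
    ultimately have u1: "1 < u" by simp
    have "v k = (1 - 1 / u) *\<^sub>R a + (1 / u) *\<^sub>R b"
    proof -
      have "(1 - 1 / u) *\<^sub>R a + (1 / u) *\<^sub>R b = (1 - 1 / u + 1 / u * (1 - u)) *\<^sub>R a + (1 / u * u) *\<^sub>R v k"
        unfolding b_eq by (simp add: scaleR_add_left scaleR_add_right)
      also have "1 - 1 / u + 1 / u * (1 - u) = 0" using u1 by (simp add: field_simps)
      also have "1 / u * u = 1" using u1 by simp
      finally show ?thesis by simp
    qed
    moreover have "a \<noteq> b" using a b by auto
    ultimately have "v k \<in> open_segment a b" using u1 by (auto simp: in_segment intro!: exI[of _ "1 / u"])
    moreover have "v k \<in> pts i j" using ikj by (simp add: v_in_pts)
    ultimately show False using packingD(4)[OF T s(1) a(1) b(1)] by blast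
  qed
  have "?L1 a * ?L2 b < ?L2 a * ?L1 b"
    using orient_product[of "v k" "v j" a "v i" b] mult_pos_pos[OF pos ne] by simp
  then obtain z where z: "z \<in> open_segment a b" "0 < ?L1 z" "0 < ?L2 z"
    using crossing_point L by blast
  obtain u where u: "0 < u" "u < 1" "z = (1 - u) *\<^sub>R a + u *\<^sub>R b" using z(1) by (auto simp: in_segment)
  have zs: "z \<in> convex hull s"
    using z(1) a(1) b(1) closed_segment_subset_convex_hull[of a "convex hull s" b] hull_inc[of _ s]
      open_closed_segment by (metis hull_hull subsetD)
  have L3: "0 \<le> ?L3 x" if "x \<in> s" for x using base_orient that sub by blast
  have z3: "?L3 z = (1 - u) * ?L3 a + u * ?L3 b" unfolding u(3) by (simp add: orient_affine2)
  then have "0 \<le> ?L3 z" using u L3 a b by simp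
  have "\<exists>w \<in> convex hull s. 0 < ?L1 w \<and> 0 < ?L2 w \<and> 0 < ?L3 w"
  proof (cases "?L3 z = 0")
    case False
    then show ?thesis using zs z \<open>0 \<le> ?L3 z\<close> by force
  next
    \<comment> \<open>Here \<open>z\<close> is only on the line of the base. Moving it slightly
      towards a vertex of \<open>s\<close> off that line keeps \<open>?L1\<close> and
      \<open>?L2\<close> positive and makes \<open>?L3\<close> positive.\<close>
    case True
    have "v j \<noteq> v i" using pos by auto
    then obtain l where l: "l \<in> s" "?L3 l \<noteq> 0"
      using collinear_if_orient_zero[of "v j" "v i" s] packingD(3)[OF T s(1)] by blast
    have l3: "0 < ?L3 l" using L3 l by force
    define f where "f = (\<lambda>e. (1 - e) *\<^sub>R z + e *\<^sub>R l)"
    have "\<forall>\<^sub>F e in at_right 0. 0 < orient p q (f e)" if "0 < orient p q z" for p q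
    proof -
      have "((\<lambda>e. (1 - e) * orient p q z + e * orient p q l) \<longlongrightarrow> (1 - 0) * orient p q z + 0 * orient p q l) (at_right 0)"
        by (intro tendsto_intros)
      then have "\<forall>\<^sub>F e in at_right 0. 0 < (1 - e) * orient p q z + e * orient p q l"
        using that by (intro order_tendstoD(1)) auto
      then show ?thesis by (simp add: f_def orient_affine2)
    qed
    then have "\<forall>\<^sub>F e in at_right 0. 0 < ?L1 (f e) \<and> 0 < ?L2 (f e)"
      using z by (intro eventually_conj) auto
    moreover have "\<forall>\<^sub>F e in at_right (0::real). 0 < e \<and> e < 1"
      using eventually_at_right_real[of 0 "1::real"] by simp
    ultimately have "\<forall>\<^sub>F e in at_right 0. (0 < ?L1 (f e) \<and> 0 < ?L2 (f e)) \<and> (0 < e \<and> e < 1)"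
      by (rule eventually_conj)
    then obtain e where e: "0 < ?L1 (f e)" "0 < ?L2 (f e)" "0 < e" "e < 1"
      using eventually_happens'[OF trivial_limit_at_right_real] by blast
    have "0 < ?L3 (f e)" unfolding f_def orient_affine2[OF diff_add_cancel] using True l3 e by simp
    moreover have "f e \<in> convex hull s" unfolding f_def
      using e zs l hull_inc[of l s] by (intro convexD_alt) auto
    ultimately show ?thesis using e by blast
  qed
  then obtain w where w: "w \<in> convex hull s" "0 < ?L1 w" "0 < ?L2 w" "0 < ?L3 w" by blast
  then have "interior (convex hull s) \<inter> interior (convex hull {v i, v k, v j}) \<noteq> {}"
    using packingD(2,3)[OF T s(1)] by (intro interiors_meet[of _ w] interior_triangleI)
  then show False using packingD(5)[OF T t s] by blast
qed

end

end

section \<open>The Catalan-type recursion for fillings\<close>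

lemma packing_restrict:
  assumes "packing V T" "W \<subseteq> V"
  shows "packing W {s \<in> T. s \<subseteq> W}"
  unfolding packing_def
proof (intro conjI ballI impI)
  fix t p q assume t: "t \<in> {s \<in> T. s \<subseteq> W}" and "p \<in> t" "q \<in> t"
  then have "open_segment p q \<inter> V = {}" using packingD(4)[OF assms(1), of t] by simp
  then show "open_segment p q \<inter> W = {}" using assms(2) by blast
qed (use packingD(2,3,5)[OF assms(1)] in simp_all)

context convex_chain
begin

text \<open>The midpoint of the base is a limit of points of the polygon off the base, so by
  closedness it lies in some triangle. As all points lie on one side of the base line, it lies on an
  edge along that line. This edge contains no end of the base, and the base no end of the edge, in
  the interior, so they coincide.\<close>

lemma base_triangle_exists:
  assumes ij: "i < j" "j \<le> N" and cl: "clear i j (pts i j)" and nc: "\<not> collinear (pts i j)"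
    and T: "T \<in> fillings i j"
  obtains k where "i < k" "k < j" "{v i, v k, v j} \<in> T" "0 < orient (v i) (v k) (v j)"
proof -
  let ?U = "\<Union>t\<in>T. convex hull t" and ?L = "orient (v j) (v i)"
  have pk: "packing (pts i j) T" and cover: "?U \<union> closed_segment (v i) (v j) = convex hull (pts i j)"
    using T by (auto simp: fillings_def)
  have vij: "v i \<noteq> v j" using ij v_eq_iff by auto
  have L: "0 \<le> ?L x" if x: "x \<in> pts i j" for x
  proof -
    obtain l where l: "i \<le> l" "l \<le> j" "x = v l" using x by (auto simp: pts_def)
    then show ?thesis
      using orient_nonneg'[of i l j] ij orient_rotate[of "v j" "v i" x] orient_rotate[of "v i" x "v j"]
      by simp
  qed
  obtain l where l: "l \<in> pts i j" "?L l \<noteq> 0"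
    using nc collinear_if_orient_zero vij by metis
  have l0: "0 < ?L l" using L l by force
  define m where "m = (1/2) *\<^sub>R v i + (1/2) *\<^sub>R v j"
  have m_open: "m \<in> open_segment (v i) (v j)"
    using vij by (auto simp: in_segment m_def intro!: exI[of _ "1/2"])
  have mh: "m \<in> convex hull (pts i j)"
  proof -
    have "closed_segment (v i) (v j) \<subseteq> convex hull (pts i j)"
      unfolding segment_convex_hull using ij by (intro hull_mono) (auto simp: v_in_pts)
    then show ?thesis using m_open open_closed_segment by blast
  qed
  have Lm: "?L m = 0" unfolding m_def by (subst orient_affine2) simp_all
  have "closed ?U"
    using finite_packing[OF pk] packingD(2)[OF pk]
    by (intro closed_UN ballI compact_imp_closed finite_imp_compact_convex_hull)
      (auto intro: card_ge_0_finite)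
  \<comment> \<open>These points approach \<open>m\<close> off the base line, where the base segment
    contributes nothing to the covering.\<close>
  define f where "f = (\<lambda>e::real. (1 - e) *\<^sub>R m + e *\<^sub>R l)"
  have "\<forall>\<^sub>F e in at_right 0. f e \<in> ?U"
  proof -
    have "\<forall>\<^sub>F e in at_right (0::real). 0 < e \<and> e < 1"
      using eventually_at_right_real[of 0 "1::real"] by simp
    then show ?thesis
    proof eventually_elim
      case (elim e)
      have "f e \<in> convex hull (pts i j)" unfolding f_def
        using elim mh l hull_inc[of l "pts i j"] by (intro convexD_alt) auto
      moreover have "?L (f e) = e * ?L l" unfolding f_def orient_affine2[OF diff_add_cancel] using Lm by simp
      then have "?L (f e) \<noteq> 0" using elim l0 by simp
      then have "f e \<notin> closed_segment (v i) (v j)" by (auto simp: in_segment orient_affine2)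
      ultimately show ?case using cover by blast
    qed
  qed
  moreover have "(f \<longlongrightarrow> (1 - 0) *\<^sub>R m + 0 *\<^sub>R l) (at_right 0)"
    unfolding f_def by (intro tendsto_intros)
  then have "(f \<longlongrightarrow> m) (at_right 0)" by simp
  ultimately have "m \<in> ?U"
    using Lim_in_closed_set[OF \<open>closed ?U\<close>] trivial_limit_at_right_real by blast
  then obtain t where t: "t \<in> T" "m \<in> convex hull t" by blast
  have tV: "t \<subseteq> pts i j" using packingD[OF pk t(1)] by simp
  obtain x y z where xyz: "t = {x, y, z}" and D: "0 < orient x y z"
    using noncollinear_triple packingD(2,3)[OF pk t(1)] by blast
  have m_notin: "m \<notin> pts i j" using cl m_open unfolding clear_def by blast
  have edge: "{v i, v j} \<subseteq> t" if ab: "a \<in> t" "b \<in> t" and La: "?L a = 0" "?L b = 0" and m: "m \<in> closed_segment a b" for a b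
  proof -
    have mo: "m \<in> open_segment a b"
      using m m_notin ab tV unfolding open_segment_def by auto
    obtain \<xi> where \<xi>: "a = v i + \<xi> *\<^sub>R (v j - v i)"
      using La(1) orient_line[of "v i" "v j" a] vij orient_swap[of "v i" "v j" a] by auto
    obtain \<eta> where \<eta>: "b = v i + \<eta> *\<^sub>R (v j - v i)"
      using La(2) orient_line[of "v i" "v j" b] vij orient_swap[of "v i" "v j" b] by auto
    \<comment> \<open>Coordinates on the base line reduce the claim to two real intervals around
      1/2, neither of which has an end of the other in its interior.\<close>
    define g where "g = (\<lambda>s::real. v i + s *\<^sub>R (v j - v i))"
    have g_inj: "g s = g s' \<longleftrightarrow> s = s'" for s s' using vij by (simp add: g_def)
    have g_comb: "(1 - u) *\<^sub>R g s + u *\<^sub>R g s' = g ((1 - u) * s + u * s')" for u s s'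
      by (simp add: g_def algebra_simps)
    have g_seg: "g r \<in> open_segment (g s) (g s') \<longleftrightarrow> r \<in> open_segment s s'" for r s s'
      unfolding in_segment g_comb g_inj by (simp add: algebra_simps)
    have eq: "a = g \<xi>" "b = g \<eta>" "v i = g 0" "v j = g 1" using \<xi> \<eta> by (simp_all add: g_def)
    have "m = g (1/2)" by (simp add: m_def g_def vec_eq_iff field_simps)
    then have 1: "1/2 \<in> open_segment \<xi> \<eta>" using mo eq g_seg by metis
    have "a \<notin> open_segment (v i) (v j)" "b \<notin> open_segment (v i) (v j)"
      using cl ab tV unfolding clear_def by blast+
    then have 2: "\<xi> \<notin> open_segment 0 1" "\<eta> \<notin> open_segment 0 1" using eq g_seg by metis+
    have "v i \<notin> open_segment a b" "v j \<notin> open_segment a b"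
      using packingD(4)[OF pk t(1) ab] ij by (auto simp: v_in_pts)
    then have 3: "0 \<notin> open_segment \<xi> \<eta>" "1 \<notin> open_segment \<xi> \<eta>" using eq g_seg by metis+
    have "(\<xi> = 0 \<and> \<eta> = 1) \<or> (\<xi> = 1 \<and> \<eta> = 0)"
      using 1 2 3 by (auto simp: open_segment_eq_real_ivl split: if_splits)
    then show ?thesis using eq ab by auto
  qed
  obtain u w s where uws: "0 \<le> u" "0 \<le> w" "0 \<le> s" "u + w + s = 1" "m = u *\<^sub>R x + w *\<^sub>R y + s *\<^sub>R z"
    using t(2) unfolding xyz convex_hull_3 by blast
  have Ls: "0 \<le> ?L x" "0 \<le> ?L y" "0 \<le> ?L z" using L tV xyz by auto
  have "u * ?L x + w * ?L y + s * ?L z = 0" using Lm uws by (simp add: orient_affine3)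
  then have zero: "u * ?L x = 0" "w * ?L y = 0" "s * ?L z = 0"
    using uws Ls by (smt (verit) mult_nonneg_nonneg)+
  have nz: "\<not> (?L x = 0 \<and> ?L y = 0 \<and> ?L z = 0)"
    using collinear_if_orient_zero[of "v j" "v i" t] vij packingD(3)[OF pk t(1)] xyz by auto
  have seg: "p *\<^sub>R a + q *\<^sub>R b \<in> closed_segment a b" if "0 \<le> p" "0 \<le> q" "p + q = 1" for p q and a b :: "real^2"
    using that by (auto simp: in_segment intro!: exI[of _ q])
  have ninside: False if "m = a" "a \<in> t" for a using that m_notin tV by auto
  have sub: "{v i, v j} \<subseteq> t"
  \<comment> \<open>Vertices off the base line have weight 0 in \<open>m\<close>. Three vertices on
    the line would be collinear, and fewer than two would make \<open>m\<close> a marked point, so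
    exactly two are on it.\<close>
  proof (cases "?L x = 0"; cases "?L y = 0"; cases "?L z = 0")
    assume "?L x = 0" "?L y = 0" "?L z \<noteq> 0"
    then show ?thesis using zero uws seg[of u w x y] by (intro edge[of x y]) (auto simp: xyz)
  next
    assume "?L x = 0" "?L y \<noteq> 0" "?L z = 0"
    then show ?thesis using zero uws seg[of u s x z] by (intro edge[of x z]) (auto simp: xyz)
  next
    assume "?L x \<noteq> 0" "?L y = 0" "?L z = 0"
    then show ?thesis using zero uws seg[of w s y z] by (intro edge[of y z]) (auto simp: xyz)
  qed (use nz zero uws ninside[of x] ninside[of y] ninside[of z] xyz in auto)
  have "card (t - {v i, v j}) = 1"
    using sub vij packingD(2)[OF pk t(1)] by (simp add: card_Diff_subset)
  then obtain c where c: "t - {v i, v j} = {c}" by (auto simp: card_1_singleton_iff)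
  then have tc: "t = {v i, c, v j}" using sub by blast
  then obtain k where k: "i \<le> k" "k \<le> j" "c = v k" using tV by (auto simp: pts_def)
  have "k \<noteq> i" "k \<noteq> j" using c k by auto
  then have k': "i < k" "k < j" using k by auto
  have "orient (v i) (v k) (v j) \<noteq> 0"
    using packingD(3)[OF pk t(1)] collinear_iff_orient tc k by simp
  then have "0 < orient (v i) (v k) (v j)" using orient_nonneg[OF k' ij(2)] by simp
  then show ?thesis using that k' tc k t(1) by simp
qed

lemma filling_insert:
  assumes ij: "j \<le> N" and cl0: "clear i j (pts i j)" and k: "k \<in> apices i j"
    and T1: "T1 \<in> fillings i k" and T2: "T2 \<in> fillings k j"
  shows "insert {v i, v k, v j} (T1 \<union> T2) \<in> fillings i j"
proof -
  let ?t = "{v i, v k, v j}"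
  have ikj: "i < k" "k < j" and pos: "0 < orient (v i) (v k) (v j)"
    and cl: "clear i k (pts i j)" "clear k j (pts i j)"
    using k by (auto simp: apices_def)
  note ctx = ikj ij pos
  have p1: "packing (pts i k) T1" and c1: "(\<Union>t\<in>T1. convex hull t) \<union> closed_segment (v i) (v k) = convex hull (pts i k)"
    using T1 by (auto simp: fillings_def)
  have p2: "packing (pts k j) T2" and c2: "(\<Union>t\<in>T2. convex hull t) \<union> closed_segment (v k) (v j) = convex hull (pts k j)"
    using T2 by (auto simp: fillings_def)
  have ne: "v i \<noteq> v k" "v k \<noteq> v j" "v i \<noteq> v j" using ikj ij v_eq_iff by auto
  have split: "pts i j = pts i k \<union> pts k j" using ikj by (simp add: pts_split)
  have vk: "v k \<in> pts i k" "v k \<in> pts k j" using ikj by (simp_all add: v_in_pts)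
  have seg_hull: "x \<in> convex hull S" if "x \<in> open_segment p q" "p \<in> S" "q \<in> S" for x p q and S :: "(real^2) set"
    using that closed_segment_subset_convex_hull[of p S q] hull_inc[of _ S] open_closed_segment by blast
  \<comment> \<open>Only points of the other part could newly block a side, and the hulls of the
    parts share nothing but \<open>v k\<close>, which was already a point of this part.\<close>
  have e1: "open_segment p q \<inter> pts i j = {}" if "s \<in> T1" "p \<in> s" "q \<in> s" for s p q
  proof -
    have "p \<in> pts i k" "q \<in> pts i k" "open_segment p q \<inter> pts i k = {}"
      using packingD(1,4)[OF p1 that(1)] that by auto
    moreover have "x = v k" if "x \<in> open_segment p q" "x \<in> pts k j" for x
      using hulls_Int[OF ctx] seg_hull[OF that(1), of "pts i k"] hull_inc[OF that(2)] calculation by blast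
    ultimately show ?thesis using split vk by blast
  qed
  have e2: "open_segment p q \<inter> pts i j = {}" if "s \<in> T2" "p \<in> s" "q \<in> s" for s p q
  proof -
    have "p \<in> pts k j" "q \<in> pts k j" "open_segment p q \<inter> pts k j = {}"
      using packingD(1,4)[OF p2 that(1)] that by auto
    moreover have "x = v k" if "x \<in> open_segment p q" "x \<in> pts i k" for x
      using hulls_Int[OF ctx] seg_hull[OF that(1), of "pts k j"] hull_inc[OF that(2)] calculation by blast
    ultimately show ?thesis using split vk by blast
  qed
  have et: "open_segment p q \<inter> pts i j = {}" if "p \<in> ?t" "q \<in> ?t" for p q
    using that cl cl0 unfolding clear_def by (auto simp: open_segment_commute)
  have pos': "0 < orient (v k) (v j) (v i)" using pos by (metis orient_rotate)
  have d1: "interior (convex hull s) \<inter> interior (convex hull ?t) = {}" if "s \<in> T1" for s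
    using packingD(1)[OF p1 that] left_orient(1)[OF ctx] pos
    by (intro interiors_disjoint_separated[OF ne(1)]) auto
  have d2: "interior (convex hull s) \<inter> interior (convex hull ?t) = {}" if "s \<in> T2" for s
    using packingD(1)[OF p2 that] right_orient(2)[OF ctx] pos'
    by (intro interiors_disjoint_separated[OF ne(2)]) auto
  have d12: "interior (convex hull s) \<inter> interior (convex hull s') = {}" if "s \<in> T1" "s' \<in> T2" for s s'
    using packingD(1)[OF p1 that(1)] packingD(1)[OF p2 that(2)] left_orient(1)[OF ctx] right_orient(1)[OF ctx]
    by (intro interiors_disjoint_separated[OF ne(1)]) auto
  have "packing (pts i j) (insert ?t (T1 \<union> T2))"
    unfolding packing_def
  proof (intro conjI ballI impI)
    fix t assume t: "t \<in> insert ?t (T1 \<union> T2)"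
    show "t \<subseteq> pts i j"
      using t triangle_subset[OF ctx] packingD(1)[OF p1] packingD(1)[OF p2] split by blast
    show "card t = 3"
      using t ne packingD(2)[OF p1] packingD(2)[OF p2] by auto
    show "\<not> collinear t"
      using t pos packingD(3)[OF p1] packingD(3)[OF p2] collinear_iff_orient[of "v i" "v k" "v j"] by auto
    show "open_segment p q \<inter> pts i j = {}" if "p \<in> t" "q \<in> t" for p q
    proof -
      consider "t = ?t" | "t \<in> T1" | "t \<in> T2" using t by blast
      then show ?thesis
      proof cases
        case 1 then show ?thesis using et that by simp
      next
        case 2 then show ?thesis using e1 that by simp
      next
        case 3 then show ?thesis using e2 that by simp
      qed
    qed
  next
    fix s t assume s: "s \<in> insert ?t (T1 \<union> T2)" and t: "t \<in> insert ?t (T1 \<union> T2)" and st: "s \<noteq> t"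
    let ?I = "\<lambda>s. interior (convex hull s)"
    have d: "?I t' \<inter> ?I s' = {}" if "?I s' \<inter> ?I t' = {}" for s' t' :: "(real^2) set"
      using that by (simp only: Int_commute)
    consider "s = ?t" | "s \<in> T1" | "s \<in> T2" using s by blast
    then show "?I s \<inter> ?I t = {}"
    proof cases
      case 1
      then consider "t \<in> T1" | "t \<in> T2" using t st by blast
      then show ?thesis using d1 d2 d 1 by cases simp_all
    next
      case 2
      consider "t = ?t" | "t \<in> T1" | "t \<in> T2" using t by blast
      then show ?thesis using d1[OF 2] d12[OF 2, of t] packingD(5)[OF p1 _ 2, of t] st
        by cases blast+
    next
      case 3
      consider "t = ?t" | "t \<in> T1" | "t \<in> T2" using t by blast
      then show ?thesis using d2[OF 3] d12[OF _ 3, of t] packingD(5)[OF p2 _ 3, of t] st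
        by cases blast+
    qed
  qed
  moreover have "closed_segment (v i) (v k) \<subseteq> convex hull ?t" "closed_segment (v k) (v j) \<subseteq> convex hull ?t"
    "closed_segment (v i) (v j) \<subseteq> convex hull ?t"
    unfolding segment_convex_hull by (auto intro!: hull_mono)
  then have "(\<Union>t\<in>insert ?t (T1 \<union> T2). convex hull t) \<union> closed_segment (v i) (v j) = convex hull (pts i j)"
    unfolding hull_split[OF ctx] c1[symmetric] c2[symmetric] by auto
  ultimately show ?thesis by (simp add: fillings_def)
qed

lemma filling_remove:
  assumes ij: "j \<le> N" and ikj: "i < k" "k < j" and pos: "0 < orient (v i) (v k) (v j)"
    and T: "T \<in> fillings i j" and t: "{v i, v k, v j} \<in> T"
  shows "k \<in> apices i j"
    and "{s \<in> T. s \<subseteq> pts i k} \<in> fillings i k" and "{s \<in> T. s \<subseteq> pts k j} \<in> fillings k j"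
    and "T = insert {v i, v k, v j} ({s \<in> T. s \<subseteq> pts i k} \<union> {s \<in> T. s \<subseteq> pts k j})"
proof -
  let ?t = "{v i, v k, v j}"
  let ?T1 = "{s \<in> T. s \<subseteq> pts i k}" and ?T2 = "{s \<in> T. s \<subseteq> pts k j}"
  note ctx = ikj ij pos
  have pk: "packing (pts i j) T"
    and cover: "(\<Union>t\<in>T. convex hull t) \<union> closed_segment (v i) (v j) = convex hull (pts i j)"
    using T by (auto simp: fillings_def)
  have split: "pts i j = pts i k \<union> pts k j" using ikj by (simp add: pts_split)
  show "k \<in> apices i j"
    using ikj pos packingD(4)[OF pk t] by (simp add: apices_def clear_def)
  show eq: "T = insert ?t (?T1 \<union> ?T2)"
    using t triangle_separates[OF ctx pk t] by blast
  have pk1: "packing (pts i k) ?T1" and pk2: "packing (pts k j) ?T2"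
    using packing_restrict[OF pk] split by simp_all
  have seg: "closed_segment (v i) (v k) \<subseteq> convex hull (pts i k)" "closed_segment (v k) (v j) \<subseteq> convex hull (pts k j)"
    "closed_segment (v i) (v j) \<subseteq> convex hull ?t"
    unfolding segment_convex_hull using ikj by (auto intro!: hull_mono simp: v_in_pts)
  have un: "convex hull (pts i j) = convex hull ?t \<union> (\<Union>t\<in>?T1. convex hull t) \<union> (\<Union>t\<in>?T2. convex hull t)"
    using cover seg(3) by (subst (asm) eq) auto
  have sub1: "(\<Union>t\<in>?T1. convex hull t) \<subseteq> convex hull (pts i k)"
    and sub2: "(\<Union>t\<in>?T2. convex hull t) \<subseteq> convex hull (pts k j)"
    by (auto dest: hull_mono)
  have sub: "convex hull (pts i k) \<subseteq> convex hull (pts i j)" "convex hull (pts k j) \<subseteq> convex hull (pts i j)"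
    unfolding split by (simp_all add: hull_mono)
  \<comment> \<open>The other pieces meet this hull only in the edge from \<open>v i\<close> to
    \<open>v k\<close>, which the definition of \<open>fillings\<close> grants separately.\<close>
  have "convex hull (pts i k) \<subseteq> (\<Union>t\<in>?T1. convex hull t) \<union> closed_segment (v i) (v k)"
  proof
    fix x assume x: "x \<in> convex hull (pts i k)"
    then have "x \<in> convex hull (pts i j)" using sub by (simp add: subset_iff)
    then consider "x \<in> convex hull ?t" | "x \<in> (\<Union>t\<in>?T1. convex hull t)" | "x \<in> (\<Union>t\<in>?T2. convex hull t)"
      unfolding un by (elim UnE)
    then show "x \<in> (\<Union>t\<in>?T1. convex hull t) \<union> closed_segment (v i) (v k)"
    proof cases
      case 1 then show ?thesis using triangle_left_hull[OF ctx 1 x] by blast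
    next
      case 3 then show ?thesis using hulls_Int[OF ctx x] sub2 by auto
    qed blast
  qed
  then show "?T1 \<in> fillings i k" using pk1 sub1 seg(1) by (auto simp: fillings_def)
  have "convex hull (pts k j) \<subseteq> (\<Union>t\<in>?T2. convex hull t) \<union> closed_segment (v k) (v j)"
  proof
    fix x assume x: "x \<in> convex hull (pts k j)"
    then have "x \<in> convex hull (pts i j)" using sub by (simp add: subset_iff)
    then consider "x \<in> convex hull ?t" | "x \<in> (\<Union>t\<in>?T1. convex hull t)" | "x \<in> (\<Union>t\<in>?T2. convex hull t)"
      unfolding un by (elim UnE)
    then show "x \<in> (\<Union>t\<in>?T2. convex hull t) \<union> closed_segment (v k) (v j)"
    proof cases
      case 1 then show ?thesis using triangle_right_hull[OF ctx 1 x] by blast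
    next
      case 2 then show ?thesis using hulls_Int[OF ctx _ x] sub1 by auto
    qed blast
  qed
  then show "?T2 \<in> fillings k j" using pk2 sub2 seg(2) by (auto simp: fillings_def)
qed

text \<open>The parts can be read off the union because a triangle does not fit into the single
  common point of the two chains. The apex can be read off because triangles of the left part miss
  \<open>v j\<close> and those of the right part miss \<open>v i\<close>.\<close>

lemma filling_parts:
  assumes ij: "j \<le> N" and k: "i < k" "k < j" and T1: "T1 \<in> fillings i k" and T2: "T2 \<in> fillings k j"
  defines "T \<equiv> insert {v i, v k, v j} (T1 \<union> T2)"
  shows "T1 = {s \<in> T. s \<subseteq> pts i k}" "T2 = {s \<in> T. s \<subseteq> pts k j}"
    and "\<And>k'. k' \<le> N \<Longrightarrow> {v i, v k', v j} \<in> T \<Longrightarrow> k' \<noteq> i \<Longrightarrow> k' \<noteq> j \<Longrightarrow> k' = k"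
proof -
  have p: "packing (pts i k) T1" "packing (pts k j) T2" using T1 T2 by (auto simp: fillings_def)
  have Int: "pts i k \<inter> pts k j = {v k}" using pts_Int k ij by simp
  have vj: "v j \<notin> pts i k" and vi: "v i \<notin> pts k j" using k ij by (auto simp: v_in_pts_iff)
  have no: False if "card s = 3" "s \<subseteq> pts i k" "s \<subseteq> pts k j" for s
  proof -
    have "s \<subseteq> {v k}" using that Int by blast
    then show False using that(1) card_mono[of "{v k}" s] by simp
  qed
  show "T1 = {s \<in> T. s \<subseteq> pts i k}"
    using packingD(1)[OF p(1)] packingD(1,2)[OF p(2)] vj no unfolding T_def by blast
  show "T2 = {s \<in> T. s \<subseteq> pts k j}"
    using packingD(1,2)[OF p(1)] packingD(1)[OF p(2)] vi no unfolding T_def by blast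
  fix k' assume k': "k' \<le> N" "{v i, v k', v j} \<in> T" "k' \<noteq> i" "k' \<noteq> j"
  have "{v i, v k', v j} \<notin> T1" "{v i, v k', v j} \<notin> T2"
    using packingD(1)[OF p(1)] packingD(1)[OF p(2)] vi vj by blast+
  then have "{v i, v k', v j} = {v i, v k, v j}" using k' unfolding T_def by blast
  then have "v k' \<in> {v i, v k, v j}" by blast
  then show "k' = k" using k' k ij v_eq_iff by auto
qed

lemma card_fillings_rec:
  assumes ij: "i < j" "j \<le> N" and cl: "clear i j (pts i j)" and nc: "\<not> collinear (pts i j)"
  shows "card (fillings i j) = (\<Sum>k\<in>apices i j. card (fillings i k) * card (fillings k j))"
proof -
  define F where "F = (\<lambda>k (T1, T2). insert {v i, v k, v j} (T1 \<union> T2))"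
  have ap: "i < k" "k < j" "0 < orient (v i) (v k) (v j)" if "k \<in> apices i j" for k
    using that by (auto simp: apices_def)
  have "fillings i j = (\<Union>k\<in>apices i j. F k ` (fillings i k \<times> fillings k j))"
  proof (intro equalityI subsetI)
    fix T assume T: "T \<in> fillings i j"
    obtain k where k: "i < k" "k < j" "{v i, v k, v j} \<in> T" "0 < orient (v i) (v k) (v j)"
      using base_triangle_exists[OF ij cl nc T] by blast
    note r = filling_remove[OF ij(2) k(1,2,4) T k(3)]
    have "T = F k ({s \<in> T. s \<subseteq> pts i k}, {s \<in> T. s \<subseteq> pts k j})" using r(4) by (simp add: F_def)
    then show "T \<in> (\<Union>k\<in>apices i j. F k ` (fillings i k \<times> fillings k j))" using r(1-3) by blast
  next
    fix T assume "T \<in> (\<Union>k\<in>apices i j. F k ` (fillings i k \<times> fillings k j))"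
    then show "T \<in> fillings i j" using filling_insert[OF ij(2) cl] by (auto simp: F_def)
  qed
  then have "card (fillings i j) = card (\<Union>k\<in>apices i j. F k ` (fillings i k \<times> fillings k j))" by simp
  also have "\<dots> = (\<Sum>k\<in>apices i j. card (F k ` (fillings i k \<times> fillings k j)))"
  proof (rule card_UN_disjoint)
    show "\<forall>k\<in>apices i j. finite (F k ` (fillings i k \<times> fillings k j))"
      by (simp add: finite_fillings)
    show "\<forall>k\<in>apices i j. \<forall>k'\<in>apices i j. k \<noteq> k' \<longrightarrow>
        F k ` (fillings i k \<times> fillings k j) \<inter> F k' ` (fillings i k' \<times> fillings k' j) = {}"
    proof (intro ballI impI)
      fix k k' assume k: "k \<in> apices i j" and k': "k' \<in> apices i j" and ne: "k \<noteq> k'"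
      have False if T: "T \<in> F k ` (fillings i k \<times> fillings k j)" and T': "T \<in> F k' ` (fillings i k' \<times> fillings k' j)" for T
      proof -
        obtain T1 T2 where *: "T1 \<in> fillings i k" "T2 \<in> fillings k j" "T = insert {v i, v k, v j} (T1 \<union> T2)"
          using T by (auto simp: F_def)
        have "{v i, v k', v j} \<in> T" using T' by (auto simp: F_def)
        then have "k' = k"
          using filling_parts(3)[OF ij(2) ap(1,2)[OF k] *(1,2), of k'] *(3) ap[OF k'] ij by auto
        then show False using ne by simp
      qed
      then show "F k ` (fillings i k \<times> fillings k j) \<inter> F k' ` (fillings i k' \<times> fillings k' j) = {}" by blast
    qed
  qed (rule finite_apices)
  also have "\<dots> = (\<Sum>k\<in>apices i j. card (fillings i k) * card (fillings k j))"
  proof (rule sum.cong[OF refl])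
    fix k assume k: "k \<in> apices i j"
    have "inj_on (F k) (fillings i k \<times> fillings k j)"
    proof (rule inj_onI)
      fix x y assume xy: "x \<in> fillings i k \<times> fillings k j" "y \<in> fillings i k \<times> fillings k j" "F k x = F k y"
      obtain T1 T2 S1 S2 where eq: "x = (T1, T2)" "y = (S1, S2)" by fastforce
      have m: "T1 \<in> fillings i k" "T2 \<in> fillings k j" "S1 \<in> fillings i k" "S2 \<in> fillings k j"
        using xy eq by auto
      have e: "insert {v i, v k, v j} (T1 \<union> T2) = insert {v i, v k, v j} (S1 \<union> S2)"
        using xy(3) eq by (simp add: F_def)
      have "T1 = S1" "T2 = S2"
        using filling_parts(1,2)[OF ij(2) ap(1,2)[OF k] m(1,2)] filling_parts(1,2)[OF ij(2) ap(1,2)[OF k] m(3,4)]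
        unfolding e by argo+
      then show "x = y" using eq by simp
    qed
    then show "card (F k ` (fillings i k \<times> fillings k j)) = card (fillings i k) * card (fillings k j)"
      by (simp add: card_image card_cartesian_product)
  qed
  finally show ?thesis .
qed

end

section \<open>Maximality is automatic\<close>

context convex_chain
begin

text \<open>Wherever \<open>l\<close> falls in the order relative to \<open>p\<close>,
  \<open>q\<close>, \<open>r\<close>, weak convexity puts \<open>v l\<close> on the line of one edge
  or beyond it. Inside the triangle this leaves only the edge itself, which \<open>empty\<close>
  forbids.\<close>

lemma point_in_triangle_ordered:
  assumes pqr: "p < q" "q < r" "r \<le> N" and pos: "0 < orient (v p) (v q) (v r)"
    and empty: "\<And>x y. x \<in> {v p, v q, v r} \<Longrightarrow> y \<in> {v p, v q, v r} \<Longrightarrow> open_segment x y \<inter> pts 0 N = {}"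
    and l: "l \<le> N" and hull: "v l \<in> convex hull {v p, v q, v r}"
  shows "l = p \<or> l = q \<or> l = r"
proof (rule ccontr)
  assume neg: "\<not> ?thesis"
  then have ne: "v l \<noteq> v p" "v l \<noteq> v q" "v l \<noteq> v r" using v_eq_iff l pqr by auto
  have pos': "0 < orient (v q) (v r) (v p)" "0 < orient (v r) (v p) (v q)" using pos by (metis orient_rotate)+
  have hull': "v l \<in> convex hull {v q, v r, v p}" "v l \<in> convex hull {v r, v p, v q}"
    using hull by (simp_all add: insert_commute)
  have L: "0 \<le> orient (v p) (v q) (v l)" "0 \<le> orient (v q) (v r) (v l)" "0 \<le> orient (v r) (v p) (v l)"
    using mem_triangle_iff[OF pos] hull by blast+
  have vl: "v l \<in> pts 0 N" using l by (simp add: v_in_pts)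
  have "v l \<notin> closed_segment (v p) (v q)" "v l \<notin> closed_segment (v q) (v r)" "v l \<notin> closed_segment (v r) (v p)"
    using empty[of "v p" "v q"] empty[of "v q" "v r"] empty[of "v r" "v p"] vl ne
    by (auto simp: open_segment_def)
  then have "orient (v p) (v q) (v l) \<noteq> 0" "orient (v q) (v r) (v l) \<noteq> 0" "orient (v r) (v p) (v l) \<noteq> 0"
    using triangle_edge[OF pos hull] triangle_edge[OF pos'(1) hull'(1)] triangle_edge[OF pos'(2) hull'(2)] by blast+
  then have L': "0 < orient (v p) (v q) (v l)" "0 < orient (v q) (v r) (v l)" "0 < orient (v r) (v p) (v l)"
    using L by auto
  consider "l < p" | "p < l" "l < q" | "q < l" "l < r" | "r < l" using neg by linarith
  then show False
  proof cases
    case 1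
    then have "0 \<le> orient (v l) (v p) (v r)" using orient_nonneg pqr by simp
    then show False using L'(3) orient_rotate[of "v p" "v r" "v l"] orient_swap[of "v p" "v r" "v l"] by simp
  next
    case 2
    then have "0 \<le> orient (v p) (v l) (v q)" using orient_nonneg pqr by simp
    then show False using L'(1) orient_swap2[of "v p" "v l" "v q"] by simp
  next
    case 3
    then have "0 \<le> orient (v q) (v l) (v r)" using orient_nonneg pqr by simp
    then show False using L'(2) orient_swap2[of "v q" "v l" "v r"] by simp
  next
    case 4
    then have "0 \<le> orient (v p) (v r) (v l)" using orient_nonneg pqr l by simp
    then show False using L'(3) orient_swap[of "v p" "v r" "v l"] by simp
  qed
qed

lemma pts_Int_triangle_hull:
  assumes "packing (pts 0 N) T" "t \<in> T"
  shows "pts 0 N \<inter> convex hull t \<subseteq> t"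
proof
  fix x assume x: "x \<in> pts 0 N \<inter> convex hull t"
  then obtain l where l: "l \<le> N" "x = v l" by (auto simp: pts_def)
  note t = packingD[OF assms]
  obtain x1 x2 x3 where t3: "t = {x1, x2, x3}" "0 < orient x1 x2 x3" using noncollinear_triple t(2,3) by blast
  then obtain p q r where pqr: "x1 = v p" "x2 = v q" "x3 = v r" "p \<le> N" "q \<le> N" "r \<le> N"
    using t(1) by (auto simp: pts_def)
  have pos: "0 < orient (v p) (v q) (v r)" using t3 pqr by simp
  then have pos': "0 < orient (v q) (v r) (v p)" "0 < orient (v r) (v p) (v q)" by (metis orient_rotate)+
  have eq: "t = {v p, v q, v r}" "t = {v q, v r, v p}" "t = {v r, v p, v q}" using t3 pqr by auto
  have "p \<noteq> q" "q \<noteq> r" "p \<noteq> r" using pos by auto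
  moreover have neg: False if "c < b" "b < a" "a \<le> N" "0 < orient (v a) (v b) (v c)" for a b c
    using orient_nonneg[OF that(1-3)] that(4) orient_rotate[of "v c" "v b" "v a"]
      orient_swap2[of "v a" "v c" "v b"] by linarith
  \<comment> \<open>A counterclockwise triple has cyclically increasing indices, so one of its three
    rotations is increasing.\<close>
  ultimately consider "p < q" "q < r" | "q < r" "r < p" | "r < p" "p < q"
    using neg[of r q p] neg[of p r q] neg[of q p r] pos pos' pqr by (metis linorder_neqE_nat)
  then show "x \<in> t"
  proof cases
    case 1
    then show ?thesis
      using point_in_triangle_ordered[OF 1 pqr(6) pos _ l(1)] t(4) x l unfolding eq(1) by blast
  next
    case 2
    then show ?thesis
      using point_in_triangle_ordered[OF 2 pqr(4) pos'(1) _ l(1)] t(4) x l unfolding eq(2) by blast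
  next
    case 3
    then show ?thesis
      using point_in_triangle_ordered[OF 3 pqr(5) pos'(2) _ l(1)] t(4) x l unfolding eq(3) by blast
  qed
qed

text \<open>A refining triangle has its vertices inside a triangle of \<open>T\<close>, hence among
  the vertices of that triangle by \<open>pts_Int_triangle_hull\<close>, so the two coincide. No
  triangle of \<open>T\<close> can then be missing, since the others do not reach its
  interior.\<close>

lemma triangulates_iff:
  "triangulates T (pts 0 N) \<longleftrightarrow>
    packing (pts 0 N) T \<and> (\<Union>t\<in>T. convex hull t) = convex hull (pts 0 N)"
proof
  assume "triangulates T (pts 0 N)"
  then show "packing (pts 0 N) T \<and> (\<Union>t\<in>T. convex hull t) = convex hull (pts 0 N)"
    by (auto simp: triangulates_def dissection_def packing_def)
next
  assume *: "packing (pts 0 N) T \<and> (\<Union>t\<in>T. convex hull t) = convex hull (pts 0 N)"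
  then have pk: "packing (pts 0 N) T" and un: "(\<Union>t\<in>T. convex hull t) = convex hull (pts 0 N)" by simp_all
  have "T' = T" if T': "dissection (pts 0 N) T'" "refines T' T" for T'
  proof -
    have sub: "T' \<subseteq> T"
    proof
      fix s assume s: "s \<in> T'"
      then obtain t where t: "t \<in> T" "convex hull s \<subseteq> convex hull t" using T'(2) by (auto simp: refines_def)
      have s3: "s \<subseteq> pts 0 N" "card s = 3" using T'(1) s by (auto simp: dissection_def)
      have "s \<subseteq> t" using pts_Int_triangle_hull[OF pk t(1)] t(2) s3(1) hull_subset[of s convex] by blast
      moreover have "card t = 3" using packingD(2)[OF pk t(1)] .
      ultimately have "s = t" using s3(2) by (intro card_subset_eq) (auto intro: card_ge_0_finite)
      then show "s \<in> T" using t by simp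
    qed
    moreover have "t \<in> T'" if t: "t \<in> T" for t
    proof (rule ccontr)
      assume nt: "t \<notin> T'"
      obtain x where x: "x \<in> interior (convex hull t)"
        using triangle_interior_nonempty packingD(2,3)[OF pk t] by blast
      then have "x \<in> (\<Union>t\<in>T. convex hull t)" using t interior_subset by blast
      then have "x \<in> (\<Union>t\<in>T'. convex hull t)" using un T'(1) by (simp add: dissection_def)
      then obtain s where s: "s \<in> T'" "x \<in> convex hull s" by blast
      have sT: "s \<in> T" using s sub by blast
      have "interior (convex hull s) \<inter> interior (convex hull t) \<noteq> {}"
        using interiors_meet[OF packingD(2,3)[OF pk sT] s(2) x] .
      then show False using packingD(5)[OF pk t sT] s nt by blast
    qed
    ultimately show ?thesis by blast
  qed
  moreover have "dissection (pts 0 N) T"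
    using pk un by (simp add: dissection_def packing_def)
  ultimately show "triangulates T (pts 0 N)"
    using pk by (simp add: triangulates_def packing_def)
qed

text \<open>The base segment added in \<open>fillings\<close> is harmless here, because the triangle
  over the base covers it.\<close>

lemma triangulations_eq_fillings:
  assumes "0 < N" "clear 0 N (pts 0 N)" "\<not> collinear (pts 0 N)"
  shows "{T. triangulates T (pts 0 N)} = fillings 0 N"
proof (intro equalityI subsetI)
  fix T assume "T \<in> {T. triangulates T (pts 0 N)}"
  moreover have "closed_segment (v 0) (v N) \<subseteq> convex hull (pts 0 N)"
    unfolding segment_convex_hull by (intro hull_mono) (auto simp: v_in_pts)
  ultimately show "T \<in> fillings 0 N" by (auto simp: triangulates_iff fillings_def)
next
  fix T assume T: "T \<in> fillings 0 N"
  obtain k where "{v 0, v k, v N} \<in> T"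
    using base_triangle_exists[OF assms(1) order_refl assms(2,3) T] by blast
  moreover have "closed_segment (v 0) (v N) \<subseteq> convex hull {v 0, v k, v N}"
    unfolding segment_convex_hull by (intro hull_mono) auto
  ultimately have "closed_segment (v 0) (v N) \<subseteq> (\<Union>t\<in>T. convex hull t)" by blast
  then show "T \<in> {T. triangulates T (pts 0 N)}" using T by (auto simp: triangulates_iff fillings_def)
qed

end

section \<open>Counting\<close>

text \<open>Vandermonde's identity, with \<open>b choose k\<close> in place of
  \<open>b choose (b - k)\<close>; \<open>M\<close> only has to cover the support.\<close>

lemma sum_choose_shifted:
  assumes "b \<le> M"
  shows "(\<Sum>k\<le>M. (b choose k) * (a choose (k + r))) = (a + b) choose (b + r)"
  using assms
proof (induction b arbitrary: r)
  case 0
  have "(\<Sum>k\<le>M. (0 choose k) * (a choose (k + r))) = (\<Sum>k\<in>{0}. (0 choose k) * (a choose (k + r)))"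
    by (rule sum.mono_neutral_right) auto
  then show ?case by simp
next
  case (Suc b)
  obtain L where L: "M = Suc L" using Suc.prems by (cases M) auto
  have z: "b choose M = 0" using Suc.prems by simp
  have "(\<Sum>k\<le>M. (Suc b choose k) * (a choose (k + r))) =
      (a choose r) + (\<Sum>k\<le>L. (b choose Suc k) * (a choose (Suc k + r))) + (\<Sum>k\<le>L. (b choose k) * (a choose (k + Suc r)))"
    unfolding L sum.atMost_Suc_shift by (simp add: sum.distrib algebra_simps)
  also have "(a choose r) + (\<Sum>k\<le>L. (b choose Suc k) * (a choose (Suc k + r))) = (\<Sum>k\<le>M. (b choose k) * (a choose (k + r)))"
    unfolding L sum.atMost_Suc_shift by simp
  also have "(\<Sum>k\<le>L. (b choose k) * (a choose (k + Suc r))) = (\<Sum>k\<le>M. (b choose k) * (a choose (k + Suc r)))"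
    using z by (simp add: L)
  finally show ?case using Suc.IH[of r] Suc.IH[of "Suc r"] Suc.prems by simp
qed

text \<open>The right side counts subsets of size \<open>s + t + 1\<close> of
  \<open>a + s + t\<close> ordered elements. The sum sorts them by their element of rank
  \<open>s + 1\<close>, which has \<open>s + m\<close> elements below it and
  \<open>a - 1 - m + t\<close> above.\<close>

lemma sum_choose_convolution:
  "(\<Sum>m<a. ((s + m) choose s) * ((a - 1 - m + t) choose t)) = (a + s + t) choose (s + t + 1)"
proof (cases a)
  case (Suc d)
  have "(\<Sum>m\<le>d. ((s + m) choose s) * ((d - m + t) choose t)) = (d + s + t + 1) choose (s + t + 1)"
  proof (induction t arbitrary: d)
    case 0
    have "(\<Sum>m\<le>d. (s + m) choose s) = (s + d + 1) choose (s + 1)"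
      using choose_rising_sum(1)[of s d] by simp
    then show ?case by (simp add: add.commute)
  next
    case (Suc t)
    note IHt = Suc
    show ?case
    proof (induction d)
      case (Suc d)
      have "(\<Sum>m\<le>Suc d. ((s + m) choose s) * ((Suc d - m + Suc t) choose Suc t)) =
        (\<Sum>m\<le>Suc d. ((s + m) choose s) * ((Suc d - m + t) choose Suc t)) +
        (\<Sum>m\<le>Suc d. ((s + m) choose s) * ((Suc d - m + t) choose t))"
        by (simp add: sum.distrib[symmetric] algebra_simps)
      \<comment> \<open>The summand at \<open>m = Suc d\<close> is \<open>t choose Suc t\<close>,
        which vanishes, so the range shrinks by one.\<close>
      also have "(\<Sum>m\<le>Suc d. ((s + m) choose s) * ((Suc d - m + t) choose Suc t)) =
        (\<Sum>m\<le>d. ((s + m) choose s) * ((d - m + Suc t) choose Suc t))"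
        by (simp add: Suc_diff_le)
      finally show ?case using Suc IHt[of "Suc d"] by (simp add: algebra_simps)
    qed simp
  qed
  then show ?thesis using Suc by (simp add: lessThan_Suc_atMost)
qed simp

text \<open>\<open>M\<close> is a common cut-off above the support, so that the ranges stay fixed
  while \<open>a\<close>, \<open>b\<close>, \<open>c\<close> vary in a recursion. The variable
  \<gamma> is outermost because the recursion telescopes in it.\<close>

definition triple_sum :: "nat \<Rightarrow> nat \<Rightarrow> nat \<Rightarrow> nat \<Rightarrow> nat" where
  "triple_sum M a b c =
    (\<Sum>\<gamma>\<le>M. \<Sum>\<alpha>\<le>M. \<Sum>\<beta>\<le>M. (a choose (\<alpha> + \<beta>)) * (b choose (\<beta> + \<gamma>)) * (c choose (\<gamma> + \<alpha>)))"

lemma Sum_any_triple_sum: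
  assumes "a \<le> M" "b \<le> M"
  shows "Sum_any (\<lambda>(\<alpha>, \<beta>, \<gamma>). (a choose (\<alpha> + \<beta>)) * (b choose (\<beta> + \<gamma>)) * (c choose (\<gamma> + \<alpha>))) =
    triple_sum M a b c"
proof -
  let ?f = "\<lambda>\<alpha> \<beta> \<gamma>. (a choose (\<alpha> + \<beta>)) * (b choose (\<beta> + \<gamma>)) * (c choose (\<gamma> + \<alpha>))"
  have "Sum_any (\<lambda>(\<alpha>, \<beta>, \<gamma>). ?f \<alpha> \<beta> \<gamma>) = (\<Sum>(\<alpha>, \<beta>, \<gamma>)\<in>{..M} \<times> {..M} \<times> {..M}. ?f \<alpha> \<beta> \<gamma>)"
    by (rule Sum_any.expand_superset) (use assms in auto)
  also have "\<dots> = (\<Sum>\<alpha>\<le>M. \<Sum>\<beta>\<le>M. \<Sum>\<gamma>\<le>M. ?f \<alpha> \<beta> \<gamma>)"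
    by (simp add: sum.cartesian_product)
  also have "\<dots> = (\<Sum>\<alpha>\<le>M. \<Sum>\<gamma>\<le>M. \<Sum>\<beta>\<le>M. ?f \<alpha> \<beta> \<gamma>)"
    by (intro sum.cong refl sum.swap)
  also have "\<dots> = triple_sum M a b c" unfolding triple_sum_def by (rule sum.swap)
  finally show ?thesis .
qed

lemma triple_sum_swap: "triple_sum M a b c = triple_sum M b a c"
proof -
  have "triple_sum M a b c =
    (\<Sum>\<alpha>\<le>M. \<Sum>\<gamma>\<le>M. \<Sum>\<beta>\<le>M. (a choose (\<alpha> + \<beta>)) * (b choose (\<beta> + \<gamma>)) * (c choose (\<gamma> + \<alpha>)))"
    unfolding triple_sum_def by (rule sum.swap)
  then show ?thesis unfolding triple_sum_def by (simp add: add.commute mult.commute)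
qed

lemma sum_atMost_eq_first:
  fixes g :: "nat \<Rightarrow> 'a::comm_monoid_add"
  assumes "\<And>k. 0 < k \<Longrightarrow> g k = 0"
  shows "sum g {..M} = g 0"
proof -
  have "sum g {..M} = sum g {0}" by (rule sum.mono_neutral_right) (use assms in auto)
  then show ?thesis by simp
qed

text \<open>Without points on that side, \<beta> and \<gamma> must be 0, and a Vandermonde sum over
  \<alpha> remains.\<close>

lemma triple_sum_0_middle:
  assumes "c \<le> M"
  shows "triple_sum M a 0 c = (a + c) choose c"
proof -
  have "triple_sum M a 0 c = (\<Sum>\<alpha>\<le>M. (a choose \<alpha>) * (c choose \<alpha>))"
    unfolding triple_sum_def by (simp add: sum_atMost_eq_first)
  then show ?thesis using sum_choose_shifted[OF assms, of a 0] by (simp add: mult.commute)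
qed

lemma triple_sum_0_right:
  assumes "b \<le> M"
  shows "triple_sum M a b 0 = (a + b) choose b"
proof -
  have "triple_sum M a b 0 = (\<Sum>\<beta>\<le>M. (a choose \<beta>) * (b choose \<beta>))"
    unfolding triple_sum_def by (simp add: sum_atMost_eq_first)
  then show ?thesis using sum_choose_shifted[OF assms, of a 0] by (simp add: mult.commute)
qed

text \<open>By Pascal's rule the two sides differ by a sum that telescopes in \<open>\<gamma>\<close>.\<close>

lemma triple_sum_rec:
  assumes M: "Suc b \<le> M" "Suc c \<le> M"
  shows "triple_sum M a (Suc b) (Suc c) =
    triple_sum M a b (Suc c) + triple_sum M a (Suc b) c + ((a + b + c) choose (b + c + 2))"
proof -
  \<comment> \<open>The second term of Pascal's rule. It has to be 0 at 0, where truncated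
    subtraction would give \<open>n choose 0 = 1\<close>.\<close>
  define pre where "pre = (\<lambda>n k. if k = 0 then 0 else n choose (k - 1) :: nat)"
  have pascal: "Suc n choose k = (n choose k) + pre n k" for n k
    by (cases k) (simp_all add: pre_def)
  have pre_Suc [simp]: "pre n (Suc k) = n choose k" "pre n 0 = 0" for n k by (simp_all add: pre_def)
  define X where "X = (\<lambda>\<gamma>. \<Sum>\<alpha>\<le>M. \<Sum>\<beta>\<le>M. (a choose (\<alpha> + \<beta>)) * (b choose (\<beta> + \<gamma>)) * (c choose (\<gamma> + \<alpha>)))"
  define Y where "Y = (\<lambda>\<gamma>. \<Sum>\<alpha>\<le>M. \<Sum>\<beta>\<le>M. (a choose (\<alpha> + \<beta>)) * pre b (\<beta> + \<gamma>) * pre c (\<gamma> + \<alpha>))"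
  \<comment> \<open>Pascal's rule splits the product of the last two factors into four products. The
    one without shifts occurs in both smaller sums, hence \<open>X\<close> on the left; the one with
    two shifts occurs in neither, hence \<open>Y\<close>.\<close>
  have split: "triple_sum M a (Suc b) (Suc c) + (\<Sum>\<gamma>\<le>M. X \<gamma>) =
      triple_sum M a b (Suc c) + triple_sum M a (Suc b) c + (\<Sum>\<gamma>\<le>M. Y \<gamma>)"
    unfolding triple_sum_def X_def Y_def sum.distrib[symmetric] pascal
    by (intro sum.cong refl) (simp add: algebra_simps)
  obtain L where L: "M = Suc L" using M by (cases M) auto
  have XM: "X M = 0" using M by (auto simp: X_def)
  \<comment> \<open>Raising \<gamma> by one turns \<open>Y\<close> into \<open>X\<close>, so only
    \<open>Y 0\<close> survives.\<close>
  have "(\<Sum>\<gamma>\<le>M. Y \<gamma>) = Y 0 + (\<Sum>\<gamma>\<le>L. X \<gamma>)"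
    unfolding L sum.atMost_Suc_shift by (simp add: X_def Y_def L)
  also have "(\<Sum>\<gamma>\<le>L. X \<gamma>) = (\<Sum>\<gamma>\<le>M. X \<gamma>)" using XM by (simp add: L)
  finally have tele: "(\<Sum>\<gamma>\<le>M. Y \<gamma>) = Y 0 + (\<Sum>\<gamma>\<le>M. X \<gamma>)" .
  have "Y 0 = (\<Sum>\<alpha>\<le>L. \<Sum>\<beta>\<le>L. (a choose (\<beta> + (\<alpha> + 2))) * (b choose \<beta>) * (c choose \<alpha>))"
    unfolding Y_def L sum.atMost_Suc_shift by (simp add: add.commute)
  also have "\<dots> = (\<Sum>\<alpha>\<le>L. (c choose \<alpha>) * (\<Sum>\<beta>\<le>L. (b choose \<beta>) * (a choose (\<beta> + (\<alpha> + 2)))))"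
    by (simp add: sum_distrib_left mult_ac)
  also have "\<dots> = (\<Sum>\<alpha>\<le>L. (c choose \<alpha>) * ((a + b) choose (\<alpha> + (b + 2))))"
    using M L by (subst sum_choose_shifted) (simp_all add: algebra_simps)
  also have "\<dots> = (a + b + c) choose (b + c + 2)"
    using M L by (subst sum_choose_shifted) (simp_all add: algebra_simps)
  finally show ?thesis using split tele by simp
qed

text \<open>Starting from the base, a triangulation around one corner removes one point at a time
  from either side. With \<open>s\<close> and \<open>t\<close> points to remove, this amounts to
  counting lattice paths. The conditions at \<open>k = p\<close> exclude the corner as apex while
  the polygon left over would be flat with inner points.\<close>

lemma corner_count:
  fixes f :: "nat \<Rightarrow> nat \<Rightarrow> nat"
  assumes edge: "\<And>i. f i (Suc i) = 1"
    and rec: "\<And>i j. l \<le> i \<Longrightarrow> i < p \<Longrightarrow> p < j \<Longrightarrow> j \<le> u \<Longrightarrow>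
      f i j = (\<Sum>k | k = Suc i \<and> (k = p \<longrightarrow> j = Suc p) \<or> Suc k = j \<and> (k = p \<longrightarrow> Suc i = p). f i k * f k j)"
  shows "l \<le> i \<Longrightarrow> i < p \<Longrightarrow> p < j \<Longrightarrow> j \<le> u \<Longrightarrow> f i j = (j - i - 2) choose (p - i - 1)"
proof (induction "j - i" arbitrary: i j rule: less_induct)
  case less
  define s t where st: "s = p - i - 1" "t = j - p - 1"
  have ji: "j - i - 2 = s + t" using less.prems st by simp
  let ?K = "{k. k = Suc i \<and> (k = p \<longrightarrow> j = Suc p) \<or> Suc k = j \<and> (k = p \<longrightarrow> Suc i = p)}"
  have f: "f i j = (\<Sum>k\<in>?K. f i k * f k j)" using rec less.prems by simp
  obtain j' where j': "j = Suc j'" using less.prems by (cases j) auto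
  show ?case
  proof (cases "s = 0"; cases "t = 0")
    assume "s = 0" "t = 0"
    then have e: "p = Suc i" "j = Suc p" using st less.prems by simp_all
    have "?K = {p}" using e by auto
    then show ?thesis using f e edge by simp
  next
    assume 0: "s = 0" "t \<noteq> 0"
    then have e: "p = Suc i" "p < j'" using st less.prems j' by simp_all
    have "?K = {j'}" using e j' by auto
    moreover have "f i j' = 1" using less.hyps[of j' i] less.prems e j' by simp
    ultimately show ?thesis using f e edge j' by simp
  next
    assume 0: "s \<noteq> 0" "t = 0"
    then have e: "j = Suc p" "Suc i < p" using st less.prems by simp_all
    have "?K = {Suc i}" using e by auto
    moreover have "f (Suc i) j = 1" using less.hyps[of j "Suc i"] less.prems e by simp
    ultimately show ?thesis using f e edge by simp
  next
    assume 0: "s \<noteq> 0" "t \<noteq> 0"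
    then have e: "Suc i < p" "p < j'" using st less.prems j' by simp_all
    have "?K = {Suc i, j'}" using e j' by auto
    then have "f i j = f (Suc i) j + f i j'" using f e edge j' by simp
    also have "\<dots> = (s + t - 1 choose (s - 1)) + (s + t - 1 choose s)"
      using less.hyps[of j "Suc i"] less.hyps[of j' i] less.prems e j' by (simp add: st)
    also have "\<dots> = s + t choose s" using 0 by (cases s) auto
    finally show ?thesis using ji st by simp
  qed
qed

text \<open>The arithmetic apart from the geometry: \<open>p\<close>, \<open>q\<close>,
  \<open>n\<close> are the indices of \<open>C\<close>, \<open>B\<close> and the last point. The
  rule \<open>whole\<close> lacks a summand for the apex \<open>n - 1\<close>, which is collinear
  with \<open>A\<close> and the last point. For \<open>c = 0\<close> the base is the full side
  \<open>AB\<close>, and only the corner \<open>C\<close> has to be counted.\<close>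

lemma nearly_convex_count:
  fixes f :: "nat \<Rightarrow> nat \<Rightarrow> nat" and a b c :: nat
  defines "p \<equiv> b + 1" and "q \<equiv> a + b + 2" and "n \<equiv> a + b + c + 2"
  assumes corner1: "\<And>i j. i < p \<Longrightarrow> p < j \<Longrightarrow> j \<le> q \<Longrightarrow> f i j = (j - i - 2) choose (p - i - 1)"
    and corner2: "\<And>i j. p \<le> i \<Longrightarrow> i < q \<Longrightarrow> q < j \<Longrightarrow> j \<le> n \<Longrightarrow> f i j = (j - i - 2) choose (q - i - 1)"
    and quad: "\<And>i j. 1 \<le> i \<Longrightarrow> i < p \<Longrightarrow> q < j \<Longrightarrow> j \<le> n \<Longrightarrow>
      f i j = f (i + 1) j + f i (j - 1) + (\<Sum>k\<in>{p<..<q}. f i k * f k j)"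
    and whole: "q < n \<Longrightarrow> f 0 n = f 1 n + (\<Sum>k\<in>{p<..<q}. f 0 k * f k n)"
    and M: "b \<le> M" "c \<le> M"
  shows "f 0 n = triple_sum M a b c"
proof -
  \<comment> \<open>An apex strictly inside \<open>BC\<close> leaves one polygon around
    \<open>C\<close> and one around \<open>B\<close>, so the sum is a convolution of two corner
    counts.\<close>
  have mid: "(\<Sum>k\<in>{p<..<q}. f i k * f k j) = (a + (p - i - 1) + (j - q - 1)) choose ((p - i) + (j - q) - 1)"
    if i: "i < p" and j: "q < j" "j \<le> n" for i j
  proof -
    define s t where st: "s = p - i - 1" "t = j - q - 1"
    have "(\<Sum>k\<in>{p<..<q}. f i k * f k j) = (\<Sum>m<a. f i (p + 1 + m) * f (p + 1 + m) j)"
      by (rule sum.reindex_bij_witness[of _ "\<lambda>m. p + 1 + m" "\<lambda>k. k - p - 1"]) (auto simp: p_def q_def Suc_diff_Suc numeral_2_eq_2)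
    also have "\<dots> = (\<Sum>m<a. ((s + m) choose s) * ((a - 1 - m + t) choose t))"
    proof (rule sum.cong[OF refl])
      fix m assume "m \<in> {..<a}"
      then have m: "m < a" by simp
      have "f i (p + 1 + m) = (s + m) choose s"
        using corner1[OF i, of "p + 1 + m"] m i by (simp add: p_def q_def st)
      moreover have "j - (p + 1 + m) - 2 = a - 1 - m + t" "q - (p + 1 + m) - 1 = a - 1 - m"
        using m j by (simp_all add: p_def q_def st)
      then have "f (p + 1 + m) j = (a - 1 - m + t) choose (a - 1 - m)"
        using corner2[of "p + 1 + m" j] m j by (simp add: p_def q_def)
      moreover have "(a - 1 - m + t) choose (a - 1 - m) = (a - 1 - m + t) choose t"
        using binomial_symmetric[of t "a - 1 - m + t"] by simp
      ultimately show "f i (p + 1 + m) * f (p + 1 + m) j = ((s + m) choose s) * ((a - 1 - m + t) choose t)"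
        by simp
    qed
    also have "\<dots> = (a + s + t) choose (s + t + 1)" by (rule sum_choose_convolution)
    also have "s + t + 1 = (p - i) + (j - q) - 1" using i j by (simp add: st)
    finally show ?thesis by (simp add: st)
  qed
  \<comment> \<open>The polygon is the triangle with side counts \<open>a\<close>, \<open>x\<close>,
    \<open>y\<close> after cutting off its corner \<open>A\<close>. The added binomial coefficient
    counts the triangulations in which \<open>A\<close> is joined to a subdivision point of
    \<open>BC\<close>. For \<open>x = y = 0\<close> the remaining polygon would be flat.\<close>
  have claim: "f (p - x) (q + y) + ((a + x + y - 1) choose (x + y)) = triple_sum M a x y"
    if "x \<le> b" "y \<le> c" "x + y \<noteq> 0" for x y
    using that
  proof (induction x arbitrary: y)
    case 0
    then obtain y' where y': "y = Suc y'" by (cases y) auto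
    have "f p (q + y) = (a + y') choose a"
      using corner2[of p "q + y"] 0 y' by (simp add: p_def q_def n_def)
    also have "\<dots> = (a + y') choose y'" using binomial_symmetric[of a "a + y'"] by simp
    finally show ?case using triple_sum_0_middle[of y M a] 0 M y' by simp
  next
    case (Suc x)
    note IHx = Suc.IH
    have x: "Suc x \<le> b" using Suc.prems by simp
    have "y \<le> c \<Longrightarrow> f (p - Suc x) (q + y) + ((a + Suc x + y - 1) choose (Suc x + y)) = triple_sum M a (Suc x) y" for y
    proof (induction y)
      case 0
      have "f (p - Suc x) q = (a + x) choose x"
        using corner1[of "p - Suc x" q] x by (simp add: p_def q_def)
      then show ?case using triple_sum_0_right[of "Suc x" M a] x M by simp
    next
      case (Suc y)
      have "f (p - Suc x) (q + Suc y) = f (p - x) (q + Suc y) + f (p - Suc x) (q + y) +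
          (\<Sum>k\<in>{p<..<q}. f (p - Suc x) k * f k (q + Suc y))"
        using quad[of "p - Suc x" "q + Suc y"] x Suc.prems by (simp add: p_def q_def n_def Suc_diff_le)
      also have "(\<Sum>k\<in>{p<..<q}. f (p - Suc x) k * f k (q + Suc y)) = (a + x + y) choose (x + y + 1)"
        using mid[of "p - Suc x" "q + Suc y"] x Suc.prems by (simp add: p_def q_def n_def)
      finally have "f (p - Suc x) (q + Suc y) = f (p - x) (q + Suc y) + f (p - Suc x) (q + y) + ((a + x + y) choose (x + y + 1))" .
      moreover have "f (p - x) (q + Suc y) + ((a + x + y) choose (x + y + 1)) = triple_sum M a x (Suc y)"
        using IHx[of "Suc y"] x Suc.prems by simp
      moreover have "f (p - Suc x) (q + y) + ((a + x + y) choose (x + y + 1)) = triple_sum M a (Suc x) y"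
        using Suc.IH Suc.prems by simp
      \<comment> \<open>The inhomogeneous terms of the two recursions differ; Pascal's rule for the
        correction term absorbs the difference.\<close>
      moreover have "triple_sum M a (Suc x) (Suc y) =
          triple_sum M a x (Suc y) + triple_sum M a (Suc x) y + ((a + x + y) choose (x + y + 2))"
        using triple_sum_rec[of x M y a] x Suc.prems M by simp
      ultimately show ?case by simp
    qed
    then show ?case using Suc.prems by simp
  qed
  show ?thesis
  proof (cases "c = 0")
    case True
    then have "f 0 n = (a + b) choose b"
      using corner1[of 0 q] by (simp add: p_def q_def n_def)
    then show ?thesis using triple_sum_0_right[OF M(1), of a] True by simp
  next
    case False
    then have "f 0 n = f 1 n + ((a + b + c - 1) choose (b + c))"
      using whole mid[of 0 n] by (simp add: p_def q_def n_def)
    also have "\<dots> = triple_sum M a b c"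
      using claim[of b c] False by (simp add: p_def q_def n_def add_ac)
    finally show ?thesis .
  qed
qed

section \<open>The subdivided triangle\<close>

text \<open>One unit of the parameter per side. It is used on the half-open interval from 0 to 3, so
  that \<open>A\<close> has the single parameter 0 although the third side also ends there.\<close>

definition boundary_point :: "real^2 \<Rightarrow> real^2 \<Rightarrow> real^2 \<Rightarrow> real \<Rightarrow> real^2" where
  "boundary_point A C B x =
    (if x \<le> 1 then (1 - x) *\<^sub>R A + x *\<^sub>R C
     else if x \<le> 2 then (2 - x) *\<^sub>R C + (x - 1) *\<^sub>R B
     else (3 - x) *\<^sub>R B + (x - 2) *\<^sub>R A)"

context
  fixes A C B :: "real^2"
  assumes ACB: "0 < orient A C B"
begin

abbreviation "pt \<equiv> boundary_point A C B"

lemma pt_simps: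
  "x \<le> 1 \<Longrightarrow> pt x = (1 - x) *\<^sub>R A + x *\<^sub>R C"
  "1 \<le> x \<Longrightarrow> x \<le> 2 \<Longrightarrow> pt x = (2 - x) *\<^sub>R C + (x - 1) *\<^sub>R B"
  "2 \<le> x \<Longrightarrow> pt x = (3 - x) *\<^sub>R B + (x - 2) *\<^sub>R A"
  by (auto simp: boundary_point_def)

lemma orient_AC_pt:
  "x \<le> 1 \<Longrightarrow> orient A C (pt x) = 0"
  "1 \<le> x \<Longrightarrow> x \<le> 2 \<Longrightarrow> orient A C (pt x) = (x - 1) * orient A C B"
  "2 \<le> x \<Longrightarrow> orient A C (pt x) = (3 - x) * orient A C B"
  by (simp_all add: pt_simps orient_affine2)

lemma orient_CB_pt:
  "x \<le> 1 \<Longrightarrow> orient C B (pt x) = (1 - x) * orient A C B"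
  "1 \<le> x \<Longrightarrow> x \<le> 2 \<Longrightarrow> orient C B (pt x) = 0"
  "2 \<le> x \<Longrightarrow> orient C B (pt x) = (x - 2) * orient A C B"
  by (simp_all add: pt_simps orient_affine2) (metis orient_rotate)+

lemma orient_BA_pt:
  "x \<le> 1 \<Longrightarrow> orient B A (pt x) = x * orient A C B"
  "1 \<le> x \<Longrightarrow> x \<le> 2 \<Longrightarrow> orient B A (pt x) = (2 - x) * orient A C B"
  "2 \<le> x \<Longrightarrow> orient B A (pt x) = 0"
  by (simp_all add: pt_simps orient_affine2) (metis orient_rotate)+

lemma inj_on_pt: "inj_on pt {0..<3}"
proof (rule linorder_inj_onI)
  fix x y :: real assume xy: "x < y" "x \<in> {0..<3}" "y \<in> {0..<3}"
  show "pt x \<noteq> pt y"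
  proof
    assume eq: "pt x = pt y"
    consider "y \<le> 1" | "x \<le> 1" "1 < y" "y \<le> 2" | "x \<le> 1" "2 < y" | "1 < x" "y \<le> 2"
      | "1 < x" "x \<le> 2" "2 < y" | "2 < x" by linarith
    then show False
    proof cases
      case 1 then show ?thesis using orient_CB_pt(1)[of x] orient_CB_pt(1)[of y] eq xy ACB by simp
    next
      case 2 then show ?thesis using orient_AC_pt(1)[of x] orient_AC_pt(2)[of y] eq xy ACB by simp
    next
      case 3 then show ?thesis using orient_AC_pt(1)[of x] orient_AC_pt(3)[of y] eq xy ACB by simp
    next
      case 4 then show ?thesis using orient_AC_pt(2)[of x] orient_AC_pt(2)[of y] eq xy ACB by simp
    next
      case 5 then show ?thesis using orient_CB_pt(2)[of x] orient_CB_pt(3)[of y] eq xy ACB by simp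
    next
      case 6 then show ?thesis using orient_AC_pt(3)[of x] orient_AC_pt(3)[of y] eq xy ACB by simp
    qed
  qed
qed auto

text \<open>For each distribution of the points over the sides, the area is an explicit nonnegative
  polynomial times \<open>orient A C B\<close>. The last alternative arises because
  \<open>A\<close>, with parameter 0, also ends the side that starts at 2.\<close>

lemma orient_pt_cases:
  assumes "0 \<le> x" "x < y" "y < z" "z < 3"
  shows "0 \<le> orient (pt x) (pt y) (pt z) \<and> (orient (pt x) (pt y) (pt z) = 0 \<longleftrightarrow>
    z \<le> 1 \<or> (1 \<le> x \<and> z \<le> 2) \<or> 2 \<le> x \<or> (x = 0 \<and> 2 \<le> y))"
proof -
  let ?O = "orient A C B" and ?o = "orient (pt x) (pt y) (pt z)"
  consider "z \<le> 1" | "y \<le> 1" "1 < z" "z \<le> 2" | "y \<le> 1" "2 < z" | "x \<le> 1" "1 < y" "z \<le> 2"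
    | "x \<le> 1" "1 < y" "y \<le> 2" "2 < z" | "x \<le> 1" "2 < y" | "1 < x" "z \<le> 2"
    | "1 < x" "y \<le> 2" "2 < z" | "1 < x" "x \<le> 2" "2 < y" | "2 < x" by linarith
  then show ?thesis
  proof cases
    case 1
    then have "?o = 0" using assms by (simp add: pt_simps orient_def algebra_simps)
    then show ?thesis using 1 by simp
  next
    case 2
    then have "?o = (z - 1) * (y - x) * ?O" using assms by (simp add: pt_simps orient_def algebra_simps)
    then show ?thesis using 2 assms ACB by (auto simp: zero_le_mult_iff)
  next
    case 3
    then have "?o = (3 - z) * (y - x) * ?O" using assms by (simp add: pt_simps orient_def algebra_simps)
    then show ?thesis using 3 assms ACB by (auto simp: zero_le_mult_iff)
  next
    case 4
    then have "?o = (1 - x) * (z - y) * ?O" using assms by (simp add: pt_simps orient_def algebra_simps)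
    then show ?thesis using 4 assms ACB by (auto simp: zero_le_mult_iff)
  next
    \<comment> \<open>One point on each side: the area is a sum of two nonnegative products, and
      both vanish only for \<open>x = 0\<close> and \<open>y = 2\<close>.\<close>
    case 5
    then have o: "?o = ((1 - x) * (2 - y) * (3 - z) + x * (y - 1) * (z - 2)) * ?O"
      using assms by (simp add: pt_simps orient_def algebra_simps)
    have nn: "0 \<le> (1 - x) * (2 - y) * (3 - z)" "0 \<le> x * (y - 1) * (z - 2)"
      using 5 assms by simp_all
    then have "?o = 0 \<longleftrightarrow> (1 - x) * (2 - y) * (3 - z) = 0 \<and> x * (y - 1) * (z - 2) = 0"
      using o ACB by (auto simp: add_nonneg_eq_0_iff)
    also have "\<dots> \<longleftrightarrow> x = 0 \<and> 2 \<le> y" using 5 assms by auto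
    finally show ?thesis using o nn ACB 5 assms by auto
  next
    case 6
    then have "?o = x * (z - y) * ?O" using assms by (simp add: pt_simps orient_def algebra_simps)
    then show ?thesis using 6 assms ACB by (auto simp: zero_le_mult_iff)
  next
    case 7
    then have "?o = 0" using assms by (simp add: pt_simps orient_def algebra_simps)
    then show ?thesis using 7 by simp
  next
    case 8
    then have "?o = (z - 2) * (y - x) * ?O" using assms by (simp add: pt_simps orient_def algebra_simps)
    then show ?thesis using 8 assms ACB by (auto simp: zero_le_mult_iff)
  next
    case 9
    then have "?o = (2 - x) * (z - y) * ?O" using assms by (simp add: pt_simps orient_def algebra_simps)
    then show ?thesis using 9 assms ACB by (auto simp: zero_le_mult_iff)
  next
    case 10
    then have "?o = 0" using assms by (simp add: pt_simps orient_def algebra_simps)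
    then show ?thesis using 10 by simp
  qed
qed

text \<open>Distinct collinear boundary points share a side. The second alternative is the
  wrap-around: on the third side, larger parameters are nearer to \<open>A\<close>, so they lie
  between \<open>A\<close> and \<open>pt y\<close>.\<close>

lemma pt_open_segmentD:
  assumes z: "pt z \<in> open_segment (pt x) (pt y)" and xy: "0 \<le> x" "x < y" "y < 3" and z3: "0 \<le> z" "z < 3"
  shows "(x < z \<and> z < y \<and> (y \<le> 1 \<or> (1 \<le> x \<and> y \<le> 2) \<or> 2 \<le> x)) \<or> (x = 0 \<and> 2 \<le> y \<and> y < z)"
proof -
  have ne: "z \<noteq> x" "z \<noteq> y" using z by (auto simp: open_segment_def)
  obtain u where u: "0 < u" "u < 1" "pt z = (1 - u) *\<^sub>R pt x + u *\<^sub>R pt y" using z by (auto simp: in_segment)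
  have L: "orient p q (pt z) = (1 - u) * orient p q (pt x) + u * orient p q (pt y)" for p q
    unfolding u(3) by (simp add: orient_affine2)
  have between: "s < r \<and> r < t" if "(1 - u) * s + u * t = r" "s < t" for s r t :: real
  proof -
    have "r - s = u * (t - s)" "t - r = (1 - u) * (t - s)" using that by (simp_all add: algebra_simps)
    then have "0 < r - s" "0 < t - r" using u that by simp_all
    then show ?thesis by simp
  qed
  have col: "orient (pt x) (pt y) (pt z) = 0" using open_segment_orient[OF z] .
  have col': "orient (pt z) (pt x) (pt y) = 0" "orient (pt x) (pt z) (pt y) = 0"
    using col orient_rotate[of "pt z" "pt x" "pt y"] orient_rotate[of "pt x" "pt y" "pt z"]
      orient_swap2[of "pt x" "pt z" "pt y"] by simp_all
  have "(x \<le> 1 \<and> y \<le> 1 \<and> z \<le> 1) \<or> (1 \<le> x \<and> 1 \<le> z \<and> y \<le> 2 \<and> z \<le> 2) \<or>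
      (2 \<le> y \<and> (x = 0 \<or> 2 \<le> x) \<and> (z = 0 \<or> 2 \<le> z))"
    using orient_pt_cases[of z x y] orient_pt_cases[of x z y] orient_pt_cases[of x y z] col col' xy z3 ne
    by (smt (verit))
  then consider "x \<le> 1" "y \<le> 1" "z \<le> 1" | "1 \<le> x" "1 \<le> z" "y \<le> 2" "z \<le> 2"
    | "2 \<le> y" "x = 0 \<or> 2 \<le> x" "z = 0 \<or> 2 \<le> z" by blast
  then show ?thesis
  proof cases
    case 1
    then have "z * orient A C B = ((1 - u) * x + u * y) * orient A C B"
      using L[of B A] by (simp add: orient_BA_pt algebra_simps)
    then have "(1 - u) * x + u * y = z" using ACB by simp
    then show ?thesis using between[of x y z] xy 1 by simp
  next
    case 2
    then have "(z - 1) * orient A C B = ((1 - u) * (x - 1) + u * (y - 1)) * orient A C B"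
      using L[of A C] xy by (simp add: orient_AC_pt algebra_simps)
    then have "(1 - u) * (x - 1) + u * (y - 1) = z - 1" using ACB by simp
    then show ?thesis using between[of "x - 1" "y - 1" "z - 1"] xy 2 by simp
  next
    case 3
    \<comment> \<open>On the third side \<open>A\<close> gets the parameter 3 instead of 0, which
      makes the parametrisation affine there.\<close>
    define e where "e = (\<lambda>t::real. if t = 0 then 3 else t)"
    have e: "orient C B (pt t) = (e t - 2) * orient A C B" if "t = 0 \<or> 2 \<le> t" for t
      using that by (auto simp: e_def orient_CB_pt)
    have "(e z - 2) * orient A C B = ((1 - u) * (e x - 2) + u * (e y - 2)) * orient A C B"
      using L[of C B] 3 e[of x] e[of y] e[of z] by (simp add: algebra_simps)
    then have eq: "(1 - u) * (e x - 2) + u * (e y - 2) = e z - 2" using ACB by simp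
    have ey: "e y = y" using 3 by (simp add: e_def)
    show ?thesis
    proof (cases "x = 0")
      case True
      have "(1 - u) * (2 - e x) + u * (2 - e y) = 2 - e z" using eq by (simp add: algebra_simps)
      then have "2 - e x < 2 - e z \<and> 2 - e z < 2 - e y" using True xy ey by (intro between) (simp_all add: e_def)
      then show ?thesis using True 3 ey by (auto simp: e_def split: if_splits)
    next
      case False
      then have "e x - 2 < e z - 2 \<and> e z - 2 < e y - 2" using eq xy ey by (intro between) (simp_all add: e_def)
      then show ?thesis using False 3 ey xy by (auto simp: e_def split: if_splits)
    qed
  qed
qed

lemma pt_open_segmentI:
  assumes xy: "0 \<le> x" "x < z" "z < y" "y < 3" and same: "y \<le> 1 \<or> (1 \<le> x \<and> y \<le> 2) \<or> 2 \<le> x"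
  shows "pt z \<in> open_segment (pt x) (pt y)"
proof -
  define u where "u = (z - x) / (y - x)"
  have u: "0 < u" "u < 1" using xy by (simp_all add: u_def)
  have z: "z = x + u * (y - x)" using xy by (simp add: u_def)
  have "pt z = (1 - u) *\<^sub>R pt x + u *\<^sub>R pt y"
  proof -
    consider "y \<le> 1" | "1 \<le> x" "y \<le> 2" | "2 \<le> x" using same by blast
    then show ?thesis
    proof cases
      case 1
      then have e: "pt z = (1 - z) *\<^sub>R A + z *\<^sub>R C" "pt x = (1 - x) *\<^sub>R A + x *\<^sub>R C" "pt y = (1 - y) *\<^sub>R A + y *\<^sub>R C"
        using xy by (simp_all add: pt_simps)
      then show ?thesis unfolding e by (simp add: z vec_eq_iff algebra_simps)
    next
      case 2
      then have e: "pt z = (2 - z) *\<^sub>R C + (z - 1) *\<^sub>R B" "pt x = (2 - x) *\<^sub>R C + (x - 1) *\<^sub>R B"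
        "pt y = (2 - y) *\<^sub>R C + (y - 1) *\<^sub>R B"
        using xy by (simp_all add: pt_simps)
      then show ?thesis unfolding e by (simp add: z vec_eq_iff algebra_simps)
    next
      case 3
      then have e: "pt z = (3 - z) *\<^sub>R B + (z - 2) *\<^sub>R A" "pt x = (3 - x) *\<^sub>R B + (x - 2) *\<^sub>R A"
        "pt y = (3 - y) *\<^sub>R B + (y - 2) *\<^sub>R A"
        using xy by (simp_all add: pt_simps)
      then show ?thesis unfolding e by (simp add: z vec_eq_iff algebra_simps)
    qed
  qed
  moreover have "pt x \<noteq> pt y" using inj_onD[OF inj_on_pt, of x y] xy by auto
  ultimately show ?thesis using u by (auto simp: in_segment)
qed

lemma open_segment_eq_pt_image:
  "open_segment A C = pt ` {0<..<1}" "open_segment C B = pt ` {1<..<2}" "open_segment B A = pt ` {2<..<3}"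
proof -
  have ne: "A \<noteq> C" "C \<noteq> B" "B \<noteq> A" using ACB by auto
  show "open_segment A C = pt ` {0<..<1}"
    using ne by (force simp: in_segment pt_simps image_iff)
  show "open_segment C B = pt ` {1<..<2}"
  proof (intro equalityI subsetI)
    fix x assume "x \<in> open_segment C B"
    then obtain u where u: "0 < u" "u < 1" "x = (1 - u) *\<^sub>R C + u *\<^sub>R B" by (auto simp: in_segment)
    then have "x = pt (u + 1)" by (simp add: pt_simps)
    then show "x \<in> pt ` {1<..<2}" using u by (intro image_eqI[of _ _ "u + 1"]) auto
  next
    fix x assume "x \<in> pt ` {1<..<2}"
    then obtain u where "1 < u" "u < 2" "x = pt u" by auto
    then show "x \<in> open_segment C B" using ne
      by (auto simp: in_segment pt_simps intro!: exI[of _ "u - 1"])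
  qed
  show "open_segment B A = pt ` {2<..<3}"
  proof (intro equalityI subsetI)
    fix x assume "x \<in> open_segment B A"
    then obtain u where u: "0 < u" "u < 1" "x = (1 - u) *\<^sub>R B + u *\<^sub>R A" by (auto simp: in_segment)
    then have "x = pt (u + 2)" by (simp add: pt_simps)
    then show "x \<in> pt ` {2<..<3}" using u by (intro image_eqI[of _ _ "u + 2"]) auto
  next
    fix x assume "x \<in> pt ` {2<..<3}"
    then obtain u where "2 < u" "u < 3" "x = pt u" by auto
    then show "x \<in> open_segment B A" using ne
      by (auto simp: in_segment pt_simps intro!: exI[of _ "u - 2"])
  qed
qed

end

text \<open>\<open>p\<close> and \<open>q\<close> are the indices of \<open>C\<close> and
  \<open>B\<close>, and \<open>n\<close> is that of the last point before the boundary returns to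
  \<open>A\<close>; this is \<open>B\<close> itself if \<open>c = 0\<close>.\<close>

locale subdivided_triangle =
  fixes A C B :: "real^2" and a b c :: nat and \<theta> :: "nat \<Rightarrow> real" and p q n :: nat
  assumes ACB: "0 < orient A C B"
    and pqn: "p = b + 1" "q = a + b + 2" "n = a + b + c + 2"
    and mono: "\<And>i j. i < j \<Longrightarrow> j \<le> n \<Longrightarrow> \<theta> i < \<theta> j"
    and corners: "\<theta> 0 = 0" "\<theta> p = 1" "\<theta> q = 2" "\<theta> n < 3"
begin

abbreviation "vtx i \<equiv> boundary_point A C B (\<theta> i)"

lemma order: "1 \<le> p" "p < q" "q \<le> n"
  using pqn by auto

lemma less_iff: "i \<le> n \<Longrightarrow> j \<le> n \<Longrightarrow> \<theta> i < \<theta> j \<longleftrightarrow> i < j"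
  using mono by (metis less_asym linorder_neqE_nat)

lemma le_iff: "i \<le> n \<Longrightarrow> j \<le> n \<Longrightarrow> \<theta> i \<le> \<theta> j \<longleftrightarrow> i \<le> j"
  using less_iff[of j i] by (simp flip: not_less)

lemma bounds: "i \<le> n \<Longrightarrow> 0 \<le> \<theta> i" "i \<le> n \<Longrightarrow> \<theta> i < 3"
  using le_iff[of 0 i] le_iff[of i n] corners by auto

lemma corner_iff:
  "i \<le> n \<Longrightarrow> \<theta> i \<le> 1 \<longleftrightarrow> i \<le> p" "i \<le> n \<Longrightarrow> 1 \<le> \<theta> i \<longleftrightarrow> p \<le> i"
  "i \<le> n \<Longrightarrow> \<theta> i \<le> 2 \<longleftrightarrow> i \<le> q" "i \<le> n \<Longrightarrow> 2 \<le> \<theta> i \<longleftrightarrow> q \<le> i" "i \<le> n \<Longrightarrow> \<theta> i = 0 \<longleftrightarrow> i = 0"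
  using le_iff[of i p] le_iff[of p i] le_iff[of i q] le_iff[of q i] le_iff[of i 0] bounds(1)[of i] corners pqn by auto

lemma orient_vtx:
  assumes "i < j" "j < k" "k \<le> n"
  shows "0 \<le> orient (vtx i) (vtx j) (vtx k)"
    and "0 < orient (vtx i) (vtx j) (vtx k) \<longleftrightarrow> \<not> (k \<le> p \<or> (p \<le> i \<and> k \<le> q) \<or> q \<le> i \<or> (i = 0 \<and> q \<le> j))"
proof -
  have "0 \<le> \<theta> i" "\<theta> i < \<theta> j" "\<theta> j < \<theta> k" "\<theta> k < 3" using assms mono bounds by auto
  note * = orient_pt_cases[OF ACB this]
  show "0 \<le> orient (vtx i) (vtx j) (vtx k)" using * by blast
  have "orient (vtx i) (vtx j) (vtx k) = 0 \<longleftrightarrow> (k \<le> p \<or> (p \<le> i \<and> k \<le> q) \<or> q \<le> i \<or> (i = 0 \<and> q \<le> j))"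
    using * assms corner_iff by auto
  then show "0 < orient (vtx i) (vtx j) (vtx k) \<longleftrightarrow> \<not> (k \<le> p \<or> (p \<le> i \<and> k \<le> q) \<or> q \<le> i \<or> (i = 0 \<and> q \<le> j))"
    using * by linarith
qed

sublocale convex_chain vtx n
proof
  show "inj_on vtx {..n}"
  proof (rule inj_onI)
    fix i j assume ij: "i \<in> {..n}" "j \<in> {..n}" "vtx i = vtx j"
    then have "\<theta> i = \<theta> j" using inj_onD[OF inj_on_pt[OF ACB] ij(3)] bounds by simp
    then show "i = j" using less_iff[of i j] less_iff[of j i] ij by auto
  qed
qed (rule orient_vtx(1))

section \<open>Admissible apices and the resulting recursions\<close>

definition same_side :: "nat \<Rightarrow> nat \<Rightarrow> bool" where
  "same_side i j \<longleftrightarrow> j \<le> p \<or> (p \<le> i \<and> j \<le> q) \<or> q \<le> i"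

text \<open>\<open>same_side\<close> goes by the order of indices and ignores that \<open>A\<close>
  also lies on the third side. The hypothesis \<open>wrap\<close> covers this: a segment from
  \<open>A\<close> to a point there is blocked by every later point, so its end must be the last
  one.\<close>

lemma clearI:
  assumes ij: "i \<le> i'" "i' < j'" "j' \<le> j" "j \<le> n"
    and adj: "j' = Suc i' \<or> \<not> same_side i' j'" and wrap: "i' = 0 \<Longrightarrow> q \<le> j' \<Longrightarrow> j' = j"
  shows "clear i' j' (pts i j)"
proof -
  have False if l: "i \<le> l" "l \<le> j" "vtx l \<in> open_segment (vtx i') (vtx j')" for l
  proof -
    have "(\<theta> i' < \<theta> l \<and> \<theta> l < \<theta> j' \<and> (\<theta> j' \<le> 1 \<or> (1 \<le> \<theta> i' \<and> \<theta> j' \<le> 2) \<or> 2 \<le> \<theta> i')) \<or>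
        (\<theta> i' = 0 \<and> 2 \<le> \<theta> j' \<and> \<theta> j' < \<theta> l)"
      using pt_open_segmentD[OF ACB l(3)] bounds mono ij l by simp
    then have "(i' < l \<and> l < j' \<and> same_side i' j') \<or> (i' = 0 \<and> q \<le> j' \<and> j' < l)"
      using ij l by (simp add: less_iff corner_iff same_side_def)
    then show False using adj wrap l by auto
  qed
  then show ?thesis unfolding clear_def pts_def by auto
qed

lemma not_clear:
  assumes ij: "i \<le> i'" "Suc i' < j'" "j' \<le> j" "j \<le> n" and same: "same_side i' j'"
  shows "\<not> clear i' j' (pts i j)"
proof -
  have "vtx (Suc i') \<in> open_segment (vtx i') (vtx j')"
    using ij same bounds mono
    by (intro pt_open_segmentI[OF ACB]) (simp_all add: corner_iff same_side_def)
  then show ?thesis using ij unfolding clear_def pts_def by auto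
qed

lemma in_apices_iff:
  assumes "i < k" "k < j" "j \<le> n" and wrap: "i = 0 \<Longrightarrow> q < j \<Longrightarrow> j = n"
  shows "k \<in> apices i j \<longleftrightarrow>
    \<not> (j \<le> p \<or> (p \<le> i \<and> j \<le> q) \<or> q \<le> i \<or> (i = 0 \<and> q \<le> k)) \<and>
    (k = Suc i \<or> \<not> same_side i k) \<and> (j = Suc k \<or> \<not> same_side k j)"
proof -
  \<comment> \<open>In the excluded case the triangle is flat along \<open>AB\<close>, so blocking
    by the wrap-around need not be decided.\<close>
  have 1: "clear i k (pts i j) \<longleftrightarrow> k = Suc i \<or> \<not> same_side i k" if "\<not> (i = 0 \<and> q \<le> k)"
    using clearI[of i i k j] not_clear[of i i k j] that assms by (auto simp: Suc_lessI)
  have 2: "clear k j (pts i j) \<longleftrightarrow> j = Suc k \<or> \<not> same_side k j"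
    using clearI[of i k j j] not_clear[of i k j j] assms by (auto simp: Suc_lessI)
  show ?thesis unfolding apices_def mem_Collect_eq
    using orient_vtx(2)[of i k j] assms(1-3) 1 2 by blast
qed

lemma rec:
  assumes "i < k" "k < j" "j \<le> n" "0 < orient (vtx i) (vtx k) (vtx j)" "\<not> same_side i j"
  shows "card (fillings i j) = (\<Sum>k\<in>apices i j. card (fillings i k) * card (fillings k j))"
proof (rule card_fillings_rec)
  show "clear i j (pts i j)" using assms by (intro clearI) auto
  have "\<not> collinear {vtx i, vtx k, vtx j}" using assms(4) by (simp add: collinear_iff_orient)
  moreover have "{vtx i, vtx k, vtx j} \<subseteq> pts i j" using assms by (auto simp: v_in_pts)
  ultimately show "\<not> collinear (pts i j)" using collinear_subset by blast
qed (use assms in auto)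

abbreviation "filling_count i j \<equiv> card (fillings i j)"

lemma card_fillings_total:
  assumes "b \<le> M" "c \<le> M"
  shows "filling_count 0 n = triple_sum M a b c"
proof -
  have apices_le: "k \<in> apices i j \<Longrightarrow> i < k \<and> k < j" for i j k by (simp add: apices_def)
  \<comment> \<open>Up to \<open>q\<close>, the corner \<open>C\<close> is the only one strictly
    between \<open>i\<close> and \<open>j\<close>.\<close>
  have corner1: "filling_count i j = (j - i - 2) choose (p - i - 1)" if "0 \<le> i" "i < p" "p < j" "j \<le> q" for i j
    using _ _ that
  proof (rule corner_count)
    fix i j assume ij: "i < p" "p < j" "j \<le> q"
    have "apices i j = {k. k = Suc i \<and> (k = p \<longrightarrow> j = Suc p) \<or> Suc k = j \<and> (k = p \<longrightarrow> Suc i = p)}"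
    proof (rule set_eqI)
      fix k
      show "k \<in> apices i j \<longleftrightarrow> k \<in> {k. k = Suc i \<and> (k = p \<longrightarrow> j = Suc p) \<or> Suc k = j \<and> (k = p \<longrightarrow> Suc i = p)}"
      proof (cases "i < k \<and> k < j")
        case True
        then show ?thesis
          by (subst in_apices_iff) (use ij order in \<open>auto simp: same_side_def\<close>)
      next
        case False
        then show ?thesis using apices_le[of k i j] ij by auto
      qed
    qed
    moreover have "0 < orient (vtx i) (vtx p) (vtx j)" using ij orient_vtx(2)[of i p j] order by auto
    ultimately show "filling_count i j = (\<Sum>k | k = Suc i \<and> (k = p \<longrightarrow> j = Suc p) \<or> Suc k = j \<and> (k = p \<longrightarrow> Suc i = p). filling_count i k * filling_count k j)"
      using rec[of i p j] ij order by (simp add: same_side_def)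
  qed (rule card_fillings_edge)
  have corner2: "filling_count i j = (j - i - 2) choose (q - i - 1)" if "p \<le> i" "i < q" "q < j" "j \<le> n" for i j
    using _ _ that
  proof (rule corner_count)
    fix i j assume ij: "p \<le> i" "i < q" "q < j" "j \<le> n"
    have "apices i j = {k. k = Suc i \<and> (k = q \<longrightarrow> j = Suc q) \<or> Suc k = j \<and> (k = q \<longrightarrow> Suc i = q)}"
    proof (rule set_eqI)
      fix k
      show "k \<in> apices i j \<longleftrightarrow> k \<in> {k. k = Suc i \<and> (k = q \<longrightarrow> j = Suc q) \<or> Suc k = j \<and> (k = q \<longrightarrow> Suc i = q)}"
      proof (cases "i < k \<and> k < j")
        case True
        then show ?thesis
          by (subst in_apices_iff) (use ij order in \<open>auto simp: same_side_def\<close>)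
      next
        case False
        then show ?thesis using apices_le[of k i j] ij by auto
      qed
    qed
    moreover have "0 < orient (vtx i) (vtx q) (vtx j)" using ij orient_vtx(2)[of i q j] order by auto
    ultimately show "filling_count i j = (\<Sum>k | k = Suc i \<and> (k = q \<longrightarrow> j = Suc q) \<or> Suc k = j \<and> (k = q \<longrightarrow> Suc i = q). filling_count i k * filling_count k j)"
      using rec[of i q j] ij order by (simp add: same_side_def)
  qed (rule card_fillings_edge)
  \<comment> \<open>\<open>C\<close> can be an apex only as the neighbour \<open>i + 1\<close>, and
    \<open>B\<close> only as \<open>j - 1\<close>, which is why the middle range excludes both
    ends.\<close>
  have quad: "filling_count i j = filling_count (i + 1) j + filling_count i (j - 1) + (\<Sum>k\<in>{p<..<q}. filling_count i k * filling_count k j)"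
    if ij: "1 \<le> i" "i < p" "q < j" "j \<le> n" for i j
  proof -
    have "apices i j = insert (i + 1) (insert (j - 1) {p<..<q})"
    proof (rule set_eqI)
      fix k
      show "k \<in> apices i j \<longleftrightarrow> k \<in> insert (i + 1) (insert (j - 1) {p<..<q})"
      proof (cases "i < k \<and> k < j")
        case True
        then show ?thesis
          by (subst in_apices_iff) (use ij order in \<open>auto simp: same_side_def\<close>)
      next
        case False
        then show ?thesis using apices_le[of k i j] ij order by auto
      qed
    qed
    moreover have "0 < orient (vtx i) (vtx p) (vtx j)" using ij orient_vtx(2)[of i p j] order by auto
    ultimately have "filling_count i j = (\<Sum>k\<in>insert (i + 1) (insert (j - 1) {p<..<q}). filling_count i k * filling_count k j)"
      using rec[of i p j] ij order by (simp add: same_side_def)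
    also have "\<dots> = filling_count i (i + 1) * filling_count (i + 1) j + (filling_count i (j - 1) * filling_count (j - 1) j + (\<Sum>k\<in>{p<..<q}. filling_count i k * filling_count k j))"
    proof -
      have "i + 1 \<notin> insert (j - 1) {p<..<q}" "j - 1 \<notin> {p<..<q}" using ij order by auto
      then show ?thesis by (simp only: sum.insert finite_insert finite_greaterThanLessThan simp_thms)
    qed
    also have "filling_count (j - 1) j = 1" using card_fillings_edge[of "j - 1"] ij by simp
    finally show ?thesis using card_fillings_edge by simp
  qed
  \<comment> \<open>The apex \<open>n - 1\<close> drops out because it lies on the line through
    \<open>A\<close> and the last point.\<close>
  have whole: "filling_count 0 n = filling_count 1 n + (\<Sum>k\<in>{p<..<q}. filling_count 0 k * filling_count k n)" if qn: "q < n"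
  proof -
    have "apices 0 n = insert 1 {p<..<q}"
    proof (rule set_eqI)
      fix k
      show "k \<in> apices 0 n \<longleftrightarrow> k \<in> insert 1 {p<..<q}"
      proof (cases "0 < k \<and> k < n")
        case True
        then show ?thesis
          by (subst in_apices_iff) (use qn order in \<open>auto simp: same_side_def\<close>)
      next
        case False
        then show ?thesis using apices_le[of k 0 n] order by auto
      qed
    qed
    moreover have "0 < orient (vtx 0) (vtx p) (vtx n)" using qn orient_vtx(2)[of 0 p n] order by auto
    ultimately have "filling_count 0 n = (\<Sum>k\<in>insert 1 {p<..<q}. filling_count 0 k * filling_count k n)"
      using rec[of 0 p n] qn order by (simp add: same_side_def)
    then show ?thesis using order card_fillings_edge[of 0] by simp
  qed
  show ?thesis
    by (rule nearly_convex_count[where f = "\<lambda>i j. filling_count i j" and a = a and b = b and c = c, folded pqn])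
      (use corner1 corner2 quad whole assms in auto)
qed

lemma card_triangulations:
  assumes "b \<le> M" "c \<le> M"
  shows "card {T. triangulates T (vtx ` {..n})} = triple_sum M a b c"
proof -
  have "vtx ` {..n} = pts 0 n" by (simp add: pts_def atLeast0AtMost)
  moreover have "clear 0 n (pts 0 n)" using order by (intro clearI) (auto simp: same_side_def)
  moreover have "\<not> collinear (pts 0 n)"
  proof -
    have "0 < orient (vtx 0) (vtx p) (vtx n)" using orient_vtx(2)[of 0 p n] order by auto
    then have "\<not> collinear {vtx 0, vtx p, vtx n}" by (simp add: collinear_iff_orient)
    moreover have "{vtx 0, vtx p, vtx n} \<subseteq> pts 0 n" using order by (auto simp: v_in_pts)
    ultimately show ?thesis using collinear_subset by blast
  qed
  ultimately show ?thesis
    using triangulations_eq_fillings card_fillings_total[OF assms] order by simp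
qed

end

section \<open>From \<open>Delta\<close> to the chain of boundary points\<close>

lemma card_triangulations_Delta_oriented:
  assumes ACB: "0 < orient A C B" and D: "Delta a b c A B C V" and M: "b \<le> M" "c \<le> M"
  shows "card {T. triangulates T V} = triple_sum M a b c"
proof -
  let ?pt = "boundary_point A C B"
  obtain P Q R where P: "P \<subseteq> open_segment B C" "finite P" "card P = a"
    and Q: "Q \<subseteq> open_segment C A" "finite Q" "card Q = b"
    and R: "R \<subseteq> open_segment A B" "finite R" "card R = c"
    and V: "V = {A, B, C} \<union> P \<union> Q \<union> R"
    using D unfolding Delta_def by blast
  have params: "\<exists>xs. sorted_wrt (<) xs \<and> length xs = card S \<and> set xs \<subseteq> I \<and> ?pt ` set xs = S"
    if S: "S \<subseteq> ?pt ` I" "finite S" and I: "I \<subseteq> {0..<3}" for S I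
  proof -
    define X where "X = {x \<in> I. ?pt x \<in> S}"
    have "X \<subseteq> {0..<3}" using I by (auto simp: X_def)
    then have inj: "inj_on ?pt X" by (rule inj_on_subset[OF inj_on_pt[OF ACB]])
    have img: "?pt ` X = S" using S by (auto simp: X_def)
    have fin: "finite X" using inj img S(2) finite_imageD by blast
    have "card X = card S" using card_image[OF inj] img by simp
    then show ?thesis using fin img strict_sorted_list_of_set[of X]
      by (intro exI[of _ "sorted_list_of_set X"]) (auto simp: X_def)
  qed
  have I: "{0<..<1} \<subseteq> {0..<3::real}" "{1<..<2} \<subseteq> {0..<3::real}" "{2<..<3} \<subseteq> {0..<3::real}" by auto
  obtain xs where xs: "sorted_wrt (<) xs" "length xs = b" "set xs \<subseteq> {0<..<1}" "?pt ` set xs = Q"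
    using params[OF _ _ I(1), of Q] Q open_segment_eq_pt_image(1)[OF ACB] open_segment_commute[of C A] by auto
  obtain ys where ys: "sorted_wrt (<) ys" "length ys = a" "set ys \<subseteq> {1<..<2}" "?pt ` set ys = P"
    using params[OF _ _ I(2), of P] P open_segment_eq_pt_image(2)[OF ACB] open_segment_commute[of B C] by auto
  obtain zs where zs: "sorted_wrt (<) zs" "length zs = c" "set zs \<subseteq> {2<..<3}" "?pt ` set zs = R"
    using params[OF _ _ I(3), of R] R open_segment_eq_pt_image(3)[OF ACB] open_segment_commute[of A B] by auto
  define L where "L = 0 # xs @ 1 # ys @ 2 # zs"
  define \<theta> where "\<theta> = nth L"
  define n where "n = a + b + c + 2"
  have len: "length L = Suc n" using xs ys zs by (simp add: L_def n_def)
  have sorted: "sorted_wrt (<) L"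
    using xs(1,3) ys(1,3) zs(1,3) unfolding L_def by (fastforce simp: sorted_wrt_append)
  interpret subdivided_triangle A C B a b c \<theta> "b + 1" "a + b + 2" n
  proof
    show "\<theta> i < \<theta> j" if "i < j" "j \<le> n" for i j
      using sorted_wrt_nth_less[OF sorted that(1)] that len by (simp add: \<theta>_def)
    show "\<theta> 0 = 0" by (simp add: \<theta>_def L_def)
    show "\<theta> (b + 1) = 1" using xs by (simp add: \<theta>_def L_def nth_append)
    show "\<theta> (a + b + 2) = 2" using xs ys by (simp add: \<theta>_def L_def nth_append)
    have "\<theta> n \<in> set L" using len by (simp add: \<theta>_def)
    then show "\<theta> n < 3" using xs(3) ys(3) zs(3) by (auto simp: L_def)
  qed (use ACB in \<open>simp_all add: n_def\<close>)
  have "\<theta> ` {..n} = set L"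
    using len by (auto simp: \<theta>_def set_conv_nth less_Suc_eq_le)
  then have "?pt ` \<theta> ` {..n} = V"
    using xs ys zs V by (auto simp: L_def boundary_point_def)
  then have "V = (\<lambda>i. ?pt (\<theta> i)) ` {..n}" by (simp add: image_image)
  then show ?thesis using card_triangulations[OF M] by simp
qed

text \<open>For the other orientation, exchanging \<open>A\<close> and \<open>B\<close> also
  exchanges \<open>a\<close> and \<open>b\<close>, under which the triple sum is invariant.\<close>

lemma card_triangulations_Delta:
  assumes D: "Delta a b c A B C V" and M: "a \<le> M" "b \<le> M" "c \<le> M"
  shows "card {T. triangulates T V} = triple_sum M a b c"
proof -
  have "orient A B C \<noteq> 0" using D by (simp add: Delta_def collinear_iff_orient)
  then consider "0 < orient A C B" | "0 < orient B C A"
    using orient_swap2[of A B C] orient_rotate[of B C A] by linarith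
  then show ?thesis
  proof cases
    case 1
    then show ?thesis using card_triangulations_Delta_oriented D M by blast
  next
    case 2
    have "Delta b a c B A C V"
    proof -
      obtain P Q R where *: "P \<subseteq> open_segment B C" "finite P" "card P = a"
        "Q \<subseteq> open_segment C A" "finite Q" "card Q = b"
        "R \<subseteq> open_segment A B" "finite R" "card R = c" "V = {A, B, C} \<union> P \<union> Q \<union> R"
        using D unfolding Delta_def by blast
      have "\<not> collinear {B, A, C}" using D by (simp add: Delta_def insert_commute)
      moreover have "V = {B, A, C} \<union> Q \<union> P \<union> R" using *(10) by blast
      ultimately show ?thesis unfolding Delta_def
        using * by (metis open_segment_commute)
    qed
    then show ?thesis
      using card_triangulations_Delta_oriented[OF 2] M triple_sum_swap[of M a b c] by metis
  qed
qed

theorem theorem5p5: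
  "(\<forall>a b c A B C V. Delta a b c A B C V \<longrightarrow>
      card {T. triangulates T V} =
        Sum_any (\<lambda>(\<alpha>, \<beta>, \<gamma>). (a choose (\<alpha> + \<beta>)) * (b choose (\<beta> + \<gamma>)) * (c choose (\<gamma> + \<alpha>)))) \<and>
   (\<forall>r A B C V. r \<ge> 1 \<and> Delta (r - 1) (r - 1) (r - 1) A B C V \<longrightarrow>
      card {T. triangulates T V} =
        Sum_any (\<lambda>(i, j, k). ((r - 1) choose (i + j)) * ((r - 1) choose (j + k)) * ((r - 1) choose (i + k))))"
proof -
  have main: "card {T. triangulates T V} =
      Sum_any (\<lambda>(\<alpha>, \<beta>, \<gamma>). (a choose (\<alpha> + \<beta>)) * (b choose (\<beta> + \<gamma>)) * (c choose (\<gamma> + \<alpha>)))"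
    if "Delta a b c A B C V" for a b c A B C V
    using card_triangulations_Delta[OF that, of "a + b + c"] Sum_any_triple_sum[of a "a + b + c" b c] by simp
  show ?thesis
    using main by (auto simp: add.commute)
qed

end
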